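(* Let $0\le\lambda<1$ and let $\mathcal{X}_s$ be the spherical prior (for each $n$, $x$ is a uniformly random unit vector in $\mathbb{R}^n$). Then the sequence of distributions $\mathrm{GWig}_n(\lambda,\mathcal{X}_s)$ is contiguous to the sequence $\mathrm{GWig}_n(0)$.
   Context: A spike prior is a family $\mathcal{X}=\{\mathcal{X}_n\}$ with $\mathcal{X}_n$ a probability distribution on $\mathbb{R}^n$ such that $x^{(n)}\sim\mathcal{X}_n$ satisfies $\|x^{(n)}\|\to1$ in probability. For $\lambda\ge0$, $\mathrm{GWig}_n(\lambda,\mathcal{X})$ is the law of the $n\times n$ matrix $Y=\lambda xx^\top+\frac{1}{\sqrt n}W$, where $x\sim\mathcal{X}_n$ and, independently of $x$, $W$ is an $n\times n$ GOE matrix: random symmetric, off-diagonal entries $\mathcal{N}(0,1)$, diagonal entries $\mathcal{N}(0,2)$, all entries independent except for $W_{ij}=W_{ji}$. $\mathrm{GWig}_n(0)$ denotes the case $\lambda=0$. Contiguity: for sequences of probability measures $P_n,Q_n$ on measurable spaces $(\Omega_n,\mathcal{F}_n)$, $P_n$ is contiguous to $Q_n$ if for every sequence of events $A_n\in\mathcal{F}_n$, $Q_n(A_n)\to0$ implies $P_n(A_n)\to0$ as $n\to\infty$. *)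

theory Defs
  imports "HOL-Probability.Probability"
begin

definition contiguous :: "(nat \<Rightarrow> 'a measure) \<Rightarrow> (nat \<Rightarrow> 'a measure) \<Rightarrow> bool" where
  "contiguous P Q \<longleftrightarrow>
     (\<forall>n. prob_space (P n) \<and> prob_space (Q n) \<and> sets (P n) = sets (Q n)) \<and>
     (\<forall>A. (\<forall>n. A n \<in> sets (Q n)) \<longrightarrow>
          (\<lambda>n. measure (Q n) (A n)) \<longlonglongrightarrow> 0 \<longrightarrow> (\<lambda>n. measure (P n) (A n)) \<longlonglongrightarrow> 0)"

text \<open>Since the dimension varies inside the statement, $\mathbb{R}^n$ and the space of
  $n \times n$ matrices are rendered as products of $\mathbb{R}$ over finite index sets.\<close>

abbreviation vec_space :: "nat \<Rightarrow> (nat \<Rightarrow> real) measure" where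
  "vec_space n \<equiv> PiM {..<n} (\<lambda>_. borel)"

abbreviation mat_space :: "nat \<Rightarrow> (nat \<times> nat \<Rightarrow> real) measure" where
  "mat_space n \<equiv> PiM ({..<n} \<times> {..<n}) (\<lambda>_. borel)"

definition upper_triangle :: "nat \<Rightarrow> (nat \<times> nat) set" where
  "upper_triangle n = {(i, j). i \<le> j \<and> j < n}"

text \<open>The second parameter of \<^const>\<open>normal_density\<close> is the standard deviation, so the diagonal
  entries have variance 2. The strictly lower triangle is filled in by symmetry.\<close>

definition GOE :: "nat \<Rightarrow> (nat \<times> nat \<Rightarrow> real) measure" where
  "GOE n = distr
     (PiM (upper_triangle n)
        (\<lambda>(i, j). density lborel (normal_density 0 (if i = j then sqrt 2 else 1))))
     (mat_space n)
     (\<lambda>w. \<lambda>(i, j)\<in>{..<n} \<times> {..<n}. w (min i j, max i j))"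

text \<open>A prior is a sequence of distributions, the \<open>n\<close>-th one living on \<^term>\<open>vec_space n\<close>.
  The product measure makes the spike and the noise independent.\<close>

definition GWig :: "real \<Rightarrow> (nat \<Rightarrow> (nat \<Rightarrow> real) measure) \<Rightarrow> nat \<Rightarrow> (nat \<times> nat \<Rightarrow> real) measure"
where
  "GWig lam X n = distr (X n \<Otimes>\<^sub>M GOE n) (mat_space n)
     (\<lambda>(x, W). \<lambda>(i, j)\<in>{..<n} \<times> {..<n}. lam * (x i * x j) + W (i, j) / sqrt (real n))"

definition unit_ball :: "nat \<Rightarrow> (nat \<Rightarrow> real) set" where
  "unit_ball n = {x \<in> space (vec_space n). L2_set x {..<n} \<le> 1}"

text \<open>The normalised surface measure on the unit sphere assigns to a set \<open>E\<close> the proportion of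
  the unit ball occupied by the cone $\{r x \mid x \in E,\ 0 < r \le 1\}$. Equivalently, it is the
  law of the direction $x / \|x\|$ of a Lebesgue-uniform point \<open>x\<close> of the ball. (For \<open>n = 0\<close>,
  where there are no unit vectors, this is the point mass on the one-point space.)\<close>

definition spherical_prior :: "nat \<Rightarrow> (nat \<Rightarrow> real) measure" where
  "spherical_prior n = distr
     (uniform_measure (PiM {..<n} (\<lambda>_. lborel)) (unit_ball n))
     (vec_space n)
     (\<lambda>x. \<lambda>i\<in>{..<n}. x i / L2_set x {..<n})"


subsection \<open>Well-definedness\<close>

lemma sets_PiM_lborel: "sets (PiM I (\<lambda>_. lborel :: real measure)) = sets (PiM I (\<lambda>_. borel))"
  by (intro sets_PiM_cong) auto

lemma space_PiM_lborel: "space (PiM I (\<lambda>_. lborel :: real measure)) = space (PiM I (\<lambda>_. borel))"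
  by (simp add: space_PiM)

lemma measurable_L2_set [measurable]:
  "(\<lambda>x. L2_set x {..<n}) \<in> borel_measurable (vec_space n)"
  unfolding L2_set_def by measurable

lemma sets_unit_ball [measurable]: "unit_ball n \<in> sets (vec_space n)"
  unfolding unit_ball_def by measurable

lemma measurable_direction:
  "(\<lambda>x. \<lambda>i\<in>{..<n}. x i / L2_set x {..<n}) \<in> vec_space n \<rightarrow>\<^sub>M vec_space n"
  by measurable

lemma finite_upper_triangle: "finite (upper_triangle n)"
  by (rule finite_subset[of _ "{..<n} \<times> {..<n}"]) (auto simp: upper_triangle_def)

lemma measurable_symmetrise:
  "(\<lambda>w. \<lambda>(i, j)\<in>{..<n} \<times> {..<n}. w (min i j, max i j))
     \<in> PiM (upper_triangle n)
         (\<lambda>(i, j). density lborel (normal_density 0 (if i = j then sqrt 2 else 1)))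
       \<rightarrow>\<^sub>M mat_space n"
  (is "_ \<in> ?M \<rightarrow>\<^sub>M _")
proof -
  have "(\<lambda>w. w (min i j, max i j)) \<in> ?M \<rightarrow>\<^sub>M borel" if "i < n" "j < n" for i j
  proof -
    have "(min i j, max i j) \<in> upper_triangle n"
      using that by (auto simp: upper_triangle_def)
    from measurable_component_singleton[OF this,
        of "\<lambda>(i, j). density lborel (normal_density 0 (if i = j then sqrt 2 else 1))"]
    show ?thesis by (simp cong: measurable_cong_sets)
  qed
  then show ?thesis
    by (intro measurable_restrict) auto
qed

lemma sets_GOE [simp, measurable_cong]: "sets (GOE n) = sets (mat_space n)"
  by (simp add: GOE_def)

lemma prob_space_GOE: "prob_space (GOE n)"
  unfolding GOE_def
  by (intro prob_space.prob_space_distr prob_space_PiM measurable_symmetrise)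
     (auto intro!: prob_space_normal_density)

lemma measurable_spiked:
  assumes "sets (X n) = sets (vec_space n)"
  shows "(\<lambda>(x, W). \<lambda>(i, j)\<in>{..<n} \<times> {..<n}. lam * (x i * x j) + W (i, j) / sqrt (real n))
           \<in> X n \<Otimes>\<^sub>M GOE n \<rightarrow>\<^sub>M mat_space n"
proof -
  note assms [measurable_cong]
  have "(\<lambda>(x, W). lam * (x i * x j) + W (i, j) / sqrt (real n)) \<in> X n \<Otimes>\<^sub>M GOE n \<rightarrow>\<^sub>M borel"
    if [simp]: "i < n" "j < n" for i j
    by measurable
  then show ?thesis
    unfolding case_prod_beta by (intro measurable_restrict) auto
qed

lemma sets_GWig [simp]: "sets (GWig lam X n) = sets (mat_space n)"
  by (simp add: GWig_def)

lemma prob_space_GWig: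
  assumes "prob_space (X n)" "sets (X n) = sets (vec_space n)"
  shows "prob_space (GWig lam X n)"
proof -
  interpret X: prob_space "X n" by fact
  interpret G: prob_space "GOE n" by (rule prob_space_GOE)
  interpret pair_prob_space "X n" "GOE n" ..
  show ?thesis
    unfolding GWig_def by (intro prob_space_distr measurable_spiked assms)
qed

text \<open>For \<open>lam = 0\<close> the prior plays no role.\<close>

lemma GWig_0:
  assumes "prob_space (X n)" "sets (X n) = sets (vec_space n)"
  shows "GWig 0 X n =
    distr (GOE n) (mat_space n) (\<lambda>W. \<lambda>(i, j)\<in>{..<n} \<times> {..<n}. W (i, j) / sqrt (real n))"
proof -
  interpret X: prob_space "X n" by fact
  interpret G: prob_space "GOE n" by (rule prob_space_GOE)
  interpret pair_prob_space "X n" "GOE n" ..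
  have m: "(\<lambda>W. \<lambda>(i, j)\<in>{..<n} \<times> {..<n}. W (i, j) / sqrt (real n)) \<in> GOE n \<rightarrow>\<^sub>M mat_space n"
    unfolding case_prod_beta by measurable
  have "GOE n = distr (X n \<Otimes>\<^sub>M GOE n) (GOE n) snd"
  proof (rule measure_eqI)
    fix A assume A: "A \<in> sets (GOE n)"
    have "snd -` A \<inter> space (X n \<Otimes>\<^sub>M GOE n) = space (X n) \<times> A"
      using sets.sets_into_space[OF A] by (auto simp: space_pair_measure)
    moreover have "A \<in> sets (GOE n)" by fact
    ultimately show "emeasure (GOE n) A = emeasure (distr (X n \<Otimes>\<^sub>M GOE n) (GOE n) snd) A"
      using A by (simp add: emeasure_distr G.emeasure_pair_measure_Times X.emeasure_space_1
          del: sets_GOE)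
  qed simp
  then have "distr (GOE n) (mat_space n) (\<lambda>W. \<lambda>(i, j)\<in>{..<n} \<times> {..<n}. W (i, j) / sqrt (real n))
     = distr (distr (X n \<Otimes>\<^sub>M GOE n) (GOE n) snd) (mat_space n)
         (\<lambda>W. \<lambda>(i, j)\<in>{..<n} \<times> {..<n}. W (i, j) / sqrt (real n))"
    by simp
  also have "\<dots> = GWig 0 X n"
    unfolding GWig_def by (subst distr_distr[OF m]) (auto simp: comp_def case_prod_unfold)
  finally show ?thesis by simp
qed

lemma sets_spherical_prior [simp]: "sets (spherical_prior n) = sets (vec_space n)"
  by (simp add: spherical_prior_def)

lemma emeasure_unit_ball:
  "emeasure (PiM {..<n} (\<lambda>_. lborel)) (unit_ball n) \<noteq> 0"
  "emeasure (PiM {..<n} (\<lambda>_. lborel)) (unit_ball n) \<noteq> \<infinity>"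
proof -
  let ?L = "PiM {..<n} (\<lambda>_. lborel :: real measure)"
  interpret product_sigma_finite "\<lambda>_::nat. lborel :: real measure" ..
  have box: "emeasure ?L (PiE {..<n} (\<lambda>_. {0..a})) = ennreal a ^ n"
    and box': "emeasure ?L (PiE {..<n} (\<lambda>_. {-a..a})) = ennreal (2 * a) ^ n"
    if "a \<ge> 0" for a :: real
    using that by (simp_all add: emeasure_PiM)
  have [measurable]: "unit_ball n \<in> sets ?L"
    by (simp add: sets_PiM_lborel)
  have "PiE {..<n} (\<lambda>_. {0..1 / real (Suc n)}) \<subseteq> unit_ball n"
  proof
    fix x assume x: "x \<in> PiE {..<n} (\<lambda>_. {0..1 / real (Suc n)})"
    have "L2_set x {..<n} \<le> (\<Sum>i<n. \<bar>x i\<bar>)"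
      by (rule L2_set_le_sum_abs)
    also have "\<dots> \<le> (\<Sum>i<n. 1 / real (Suc n))"
      using x by (intro sum_mono) (auto simp: PiE_iff)
    also have "\<dots> \<le> 1" by simp
    finally show "x \<in> unit_ball n"
      using x by (auto simp: unit_ball_def space_PiM PiE_iff)
  qed
  then have "emeasure ?L (PiE {..<n} (\<lambda>_. {0..1 / real (Suc n)})) \<le> emeasure ?L (unit_ball n)"
    by (intro emeasure_mono) auto
  moreover have "ennreal (1 / real (Suc n)) ^ n \<noteq> 0"
    by (simp add: ennreal_power)
  ultimately show "emeasure ?L (unit_ball n) \<noteq> 0"
    using box[of "1 / real (Suc n)"] by auto
  have "unit_ball n \<subseteq> PiE {..<n} (\<lambda>_. {-1..1})"
  proof
    fix x assume x: "x \<in> unit_ball n"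
    have "\<bar>x i\<bar> \<le> 1" if "i < n" for i
    proof -
      have "\<bar>x i\<bar> \<le> L2_set (\<lambda>i. \<bar>x i\<bar>) {..<n}"
        using that by (intro member_le_L2_set) auto
      also have "\<dots> = L2_set x {..<n}" by (simp add: L2_set_def)
      also have "\<dots> \<le> 1" using x by (simp add: unit_ball_def)
      finally show ?thesis .
    qed
    then show "x \<in> PiE {..<n} (\<lambda>_. {-1..1})"
      using x by (auto simp: unit_ball_def space_PiM PiE_iff abs_le_iff minus_le_iff)
  qed
  then have "emeasure ?L (unit_ball n) \<le> emeasure ?L (PiE {..<n} (\<lambda>_. {-1..1}))"
    by (intro emeasure_mono sets_PiM_I_finite) auto
  also have "\<dots> < \<infinity>"
    using box'[of 1] by (simp add: power_less_top_ennreal)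
  finally show "emeasure ?L (unit_ball n) \<noteq> \<infinity>" by auto
qed

lemma prob_space_uniform_unit_ball:
  "prob_space (uniform_measure (PiM {..<n} (\<lambda>_. lborel)) (unit_ball n))"
  by (rule prob_space_uniform_measure[OF emeasure_unit_ball])

lemma measurable_direction_uniform:
  "(\<lambda>x. \<lambda>i\<in>{..<n}. x i / L2_set x {..<n})
     \<in> uniform_measure (PiM {..<n} (\<lambda>_. lborel)) (unit_ball n) \<rightarrow>\<^sub>M vec_space n"
  using measurable_direction by (simp add: sets_PiM_lborel cong: measurable_cong_sets)

lemma prob_space_spherical_prior: "prob_space (spherical_prior n)"
  unfolding spherical_prior_def
  by (intro prob_space.prob_space_distr prob_space_uniform_unit_ball measurable_direction_uniform)

lemma AE_spherical_prior_unit: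
  assumes "n > 0"
  shows "AE x in spherical_prior n. L2_set x {..<n} = 1"
proof -
  let ?L = "PiM {..<n} (\<lambda>_. lborel :: real measure)"
  interpret product_sigma_finite "\<lambda>_::nat. lborel :: real measure" ..
  have "PiE {..<n} (\<lambda>_. {0}) \<in> null_sets ?L"
  proof (rule null_setsI)
    show "emeasure ?L (PiE {..<n} (\<lambda>_. {0})) = 0"
      using assms by (subst emeasure_PiM) (auto simp: power_0_left)
    show "PiE {..<n} (\<lambda>_. {0}) \<in> sets ?L"
      by (rule sets_PiM_I_finite) auto
  qed
  then have "AE x in ?L. x \<notin> PiE {..<n} (\<lambda>_. {0})"
    by (rule AE_not_in)
  then have "AE x in ?L. L2_set x {..<n} \<noteq> 0"
    using AE_space
  proof eventually_elim
    case (elim x)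
    then show ?case by (force simp: L2_set_eq_0_iff PiE_iff space_PiM extensional_def)
  qed
  then have "AE x in ?L. x \<in> unit_ball n \<longrightarrow>
      L2_set (\<lambda>i\<in>{..<n}. x i / L2_set x {..<n}) {..<n} = 1"
  proof eventually_elim
    case (elim x)
    have "L2_set (\<lambda>i\<in>{..<n}. x i / L2_set x {..<n}) {..<n} =
        L2_set (\<lambda>i. x i * (1 / L2_set x {..<n})) {..<n}"
      by (intro L2_set_cong) auto
    also have "\<dots> = L2_set x {..<n} * (1 / L2_set x {..<n})"
      by (rule L2_set_left_distrib [symmetric]) simp
    finally show ?case using elim by simp
  qed
  then have "AE x in uniform_measure ?L (unit_ball n).
      L2_set (\<lambda>i\<in>{..<n}. x i / L2_set x {..<n}) {..<n} = 1"
    by (intro AE_uniform_measureI) (simp_all add: sets_PiM_lborel)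
  then show ?thesis
    unfolding spherical_prior_def
    by (subst AE_distr_iff[OF measurable_direction_uniform]) measurable
qed

end

theory Submission
  imports Defs
begin

text \<open>By Cauchy-Schwarz it suffices to bound the second moment of the likelihood ratio, which the
  Cameron-Martin formula turns into $\mathbb{E} \exp(\frac{n \lambda^2}{2} \langle x, x'\rangle^2)$ for
  independent uniform unit vectors $x, x'$. Compare the sphere with a standard Gaussian vector \<open>z\<close>: its
  direction is uniform on the sphere and independent of its norm, and $\mathbb{E} \|z\|^2 = n$.
  Jensen's inequality over $\|z\|$ therefore gives, for each unit vector \<open>u\<close>,
  $\mathbb{E} \exp(\frac{n \lambda^2}{2} \langle x, u\rangle^2) \le
   \mathbb{E} \exp(\frac{\lambda^2}{2} \langle z, u\rangle^2) = (1 - \lambda^2)^{-1/2}$,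
  uniformly in \<open>n\<close>.\<close>

subsection \<open>Finite products of measures\<close>

text \<open>For n > 1 the matrix law is carried by the symmetric matrices and has no Lebesgue
  density on the full product space. Likelihood ratios are therefore taken before symmetrisation and
  scaling, for the independent entries of the upper triangle, and events about matrices are pulled
  back there. At that level the spike is a mean shift of size sqrt n, which is the source of the
  factor n in the exponent. The prior is given only as the cone measure of the ball. Independence of
  direction and norm is extracted from the scaling of Lebesgue measure alone; neither rotation
  invariance nor the law of the inner product is computed. The threshold comes from one Gaussian
  integral: E exp(s g^2 / 2) is finite exactly for s < 1, and it is applied with s = lam^2.
  Integrals are nonnegative throughout, so Tonelli needs no integrability; the price is that each
  cancellation needs a finiteness argument.\<close>

lemma density_PiM:
  assumes M: "product_sigma_finite M" and fM: "product_sigma_finite (\<lambda>i. density (M i) (f i))"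
    and I: "finite I" and f: "\<And>i. i \<in> I \<Longrightarrow> f i \<in> borel_measurable (M i)"
  shows "density (PiM I M) (\<lambda>x. \<Prod>i\<in>I. f i (x i)) = PiM I (\<lambda>i. density (M i) (f i))"
proof -
  interpret M: product_sigma_finite M by (rule M)
  interpret fM: product_sigma_finite "\<lambda>i. density (M i) (f i)" by (rule fM)
  have meas: "(\<lambda>x. \<Prod>i\<in>I. f i (x i)) \<in> borel_measurable (PiM I M)"
    using f by (intro borel_measurable_prod_ennreal measurable_compose[OF measurable_component_singleton]) auto
  show ?thesis
  proof (rule fM.PiM_eqI[OF I])
    show "sets (density (PiM I M) (\<lambda>x. \<Prod>i\<in>I. f i (x i))) = sets (PiM I (\<lambda>i. density (M i) (f i)))"
      by (auto intro!: sets_PiM_cong)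
  next
    fix A assume A: "\<And>i. i \<in> I \<Longrightarrow> A i \<in> sets (density (M i) (f i))"
    then have A': "i \<in> I \<Longrightarrow> A i \<in> sets (M i)" for i by simp
    have "emeasure (density (PiM I M) (\<lambda>x. \<Prod>i\<in>I. f i (x i))) (PiE I A) =
        (\<integral>\<^sup>+x. (\<Prod>i\<in>I. f i (x i)) * indicator (PiE I A) x \<partial>PiM I M)"
      using A' I by (intro emeasure_density meas sets_PiM_I_finite)
    also have "\<dots> = (\<integral>\<^sup>+x. (\<Prod>i\<in>I. f i (x i) * indicator (A i) (x i)) \<partial>PiM I M)"
    proof (rule nn_integral_cong)
      fix x assume "x \<in> space (PiM I M)"
      then have "indicator (PiE I A) x = (\<Prod>i\<in>I. indicator (A i) (x i) :: ennreal)"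
        using I by (auto simp: indicator_def space_PiM PiE_iff prod_zero_iff)
      then show "(\<Prod>i\<in>I. f i (x i)) * indicator (PiE I A) x =
          (\<Prod>i\<in>I. f i (x i) * indicator (A i) (x i))"
        by (simp add: prod.distrib)
    qed
    also have "\<dots> = (\<Prod>i\<in>I. \<integral>\<^sup>+x. f i x * indicator (A i) x \<partial>M i)"
      using f A' by (intro M.product_nn_integral_prod I) auto
    also have "\<dots> = (\<Prod>i\<in>I. emeasure (density (M i) (f i)) (A i))"
      using f A' by (intro prod.cong) (auto simp: emeasure_density)
    finally show "emeasure (density (PiM I M) (\<lambda>x. \<Prod>i\<in>I. f i (x i))) (PiE I A) =
        (\<Prod>i\<in>I. emeasure (density (M i) (f i)) (A i))" .
  qed
qed

lemma distr_PiM_pointwise: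
  assumes M: "product_sigma_finite M" and gM: "product_sigma_finite (\<lambda>i. distr (M i) (N i) (g i))"
    and I: "finite I" and g: "\<And>i. i \<in> I \<Longrightarrow> g i \<in> M i \<rightarrow>\<^sub>M N i"
  shows "distr (PiM I M) (PiM I N) (\<lambda>x. \<lambda>i\<in>I. g i (x i)) = PiM I (\<lambda>i. distr (M i) (N i) (g i))"
proof -
  interpret M: product_sigma_finite M by (rule M)
  interpret gM: product_sigma_finite "\<lambda>i. distr (M i) (N i) (g i)" by (rule gM)
  have meas: "(\<lambda>x. \<lambda>i\<in>I. g i (x i)) \<in> PiM I M \<rightarrow>\<^sub>M PiM I N"
    using g by (intro measurable_restrict measurable_compose[OF measurable_component_singleton])
  show ?thesis
  proof (rule gM.PiM_eqI[OF I])
    show "sets (distr (PiM I M) (PiM I N) (\<lambda>x. \<lambda>i\<in>I. g i (x i))) =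
        sets (PiM I (\<lambda>i. distr (M i) (N i) (g i)))"
      by (auto intro!: sets_PiM_cong)
  next
    fix A assume "\<And>i. i \<in> I \<Longrightarrow> A i \<in> sets (distr (M i) (N i) (g i))"
    then have A: "i \<in> I \<Longrightarrow> A i \<in> sets (N i)" for i by simp
    have "emeasure (distr (PiM I M) (PiM I N) (\<lambda>x. \<lambda>i\<in>I. g i (x i))) (PiE I A) =
        emeasure (PiM I M) ((\<lambda>x. \<lambda>i\<in>I. g i (x i)) -` PiE I A \<inter> space (PiM I M))"
      using A I by (intro emeasure_distr meas sets_PiM_I_finite)
    also have "(\<lambda>x. \<lambda>i\<in>I. g i (x i)) -` PiE I A \<inter> space (PiM I M) =
        PiE I (\<lambda>i. g i -` A i \<inter> space (M i))"
      by (auto simp: space_PiM PiE_iff restrict_def)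
    also have "emeasure (PiM I M) \<dots> = (\<Prod>i\<in>I. emeasure (M i) (g i -` A i \<inter> space (M i)))"
      using A g I by (intro M.emeasure_PiM) (auto intro: measurable_sets)
    also have "\<dots> = (\<Prod>i\<in>I. emeasure (distr (M i) (N i) (g i)) (A i))"
      using A g by (intro prod.cong refl) (auto simp: emeasure_distr)
    finally show "emeasure (distr (PiM I M) (PiM I N) (\<lambda>x. \<lambda>i\<in>I. g i (x i))) (PiE I A) =
        (\<Prod>i\<in>I. emeasure (distr (M i) (N i) (g i)) (A i))" .
  qed
qed

text \<open>Change of variables for a dilation. The Jacobian is collected one coordinate at a time,
  each contributing 1 / c.\<close>

lemma distr_PiM_lborel_scale:
  fixes c :: real
  assumes "c > 0" and I: "finite I"
  shows "distr (PiM I (\<lambda>_. lborel)) (PiM I (\<lambda>_. borel)) (\<lambda>x. \<lambda>i\<in>I. c * x i) =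
    density (PiM I (\<lambda>_. lborel)) (\<lambda>_. ennreal (1 / c) ^ card I)"
proof -
  have eq: "distr lborel borel ((*) c) = density lborel (\<lambda>_. ennreal (1 / c))"
    using lborel_distr_mult[of c] assms by (simp add: divide_inverse)
  have sf: "sigma_finite_measure (density lborel (\<lambda>_::real. ennreal (1 / c)))"
    by (subst sigma_finite_measure.sigma_finite_iff_density_finite[OF sigma_finite_lborel]) auto
  have "distr (PiM I (\<lambda>_. lborel)) (PiM I (\<lambda>_. borel)) (\<lambda>x. \<lambda>i\<in>I. c * x i) =
      PiM I (\<lambda>_. distr lborel borel ((*) c))"
    by (intro distr_PiM_pointwise I) (auto simp: product_sigma_finite_def eq sf sigma_finite_lborel)
  also have "\<dots> = density (PiM I (\<lambda>_. lborel)) (\<lambda>x. \<Prod>i\<in>I. ennreal (1 / c))"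
    unfolding eq by (intro density_PiM[symmetric] I) (auto simp: product_sigma_finite_def sf sigma_finite_lborel)
  finally show ?thesis by simp
qed

subsection \<open>Gaussian measures\<close>

definition gauss :: "real \<Rightarrow> real measure" where
  "gauss \<sigma> = density lborel (normal_density 0 \<sigma>)"

lemma sets_gauss [simp, measurable_cong]: "sets (gauss \<sigma>) = sets borel"
  by (simp add: gauss_def)

lemma space_gauss [simp]: "space (gauss \<sigma>) = UNIV"
  by (simp add: gauss_def)

lemma prob_space_gauss: "\<sigma> > 0 \<Longrightarrow> prob_space (gauss \<sigma>)"
  unfolding gauss_def by (rule prob_space_normal_density)

text \<open>One-dimensional Cameron-Martin formula, by expanding the square in the exponent of the
  normal density.\<close>

lemma distr_gauss_shift:
  assumes \<sigma>: "\<sigma> > 0"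
  shows "distr (gauss \<sigma>) borel (\<lambda>x. x + m) =
    density (gauss \<sigma>) (\<lambda>x. ennreal (exp (m * x / \<sigma>\<^sup>2 - m\<^sup>2 / (2 * \<sigma>\<^sup>2))))"
proof -
  \<comment> \<open>Writing the centred density at x as the density with mean m at m + x makes it a
    function of the shifted point, so it passes through the push-forward.\<close>
  have "distr (gauss \<sigma>) borel (\<lambda>x. x + m) =
      distr (density lborel (\<lambda>x. normal_density m \<sigma> (m + x))) borel ((+) m)"
    by (simp add: gauss_def normal_density_def add.commute[of _ m])
  also have "\<dots> = density (distr lborel borel ((+) m)) (normal_density m \<sigma>)"
    by (subst density_distr) auto
  also have "\<dots> = density lborel (normal_density m \<sigma>)"
    by (simp add: lborel_distr_plus)
  also have "normal_density m \<sigma> =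
      (\<lambda>x. normal_density 0 \<sigma> x * exp (m * x / \<sigma>\<^sup>2 - m\<^sup>2 / (2 * \<sigma>\<^sup>2)))"
  proof
    fix x
    have "exp (- (x - m)\<^sup>2 / (2 * \<sigma>\<^sup>2)) =
        exp (- x\<^sup>2 / (2 * \<sigma>\<^sup>2)) * exp (m * x / \<sigma>\<^sup>2 - m\<^sup>2 / (2 * \<sigma>\<^sup>2))"
      unfolding exp_add[symmetric]
      using \<sigma> by (intro arg_cong[where f=exp]) (simp add: field_simps power2_eq_square)
    then show "normal_density m \<sigma> x = normal_density 0 \<sigma> x * exp (m * x / \<sigma>\<^sup>2 - m\<^sup>2 / (2 * \<sigma>\<^sup>2))"
      by (simp add: normal_density_def)
  qed
  also have "density lborel (\<lambda>x. ennreal (normal_density 0 \<sigma> x * exp (m * x / \<sigma>\<^sup>2 - m\<^sup>2 / (2 * \<sigma>\<^sup>2)))) =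
      density (gauss \<sigma>) (\<lambda>x. ennreal (exp (m * x / \<sigma>\<^sup>2 - m\<^sup>2 / (2 * \<sigma>\<^sup>2))))"
    unfolding gauss_def by (subst density_density_eq) (auto simp: ennreal_mult)
  finally show ?thesis .
qed

text \<open>The moment generating function is read off from Cameron-Martin: with m = c \<sigma>^2
  the shift density is exp (c x) up to a constant, and a shifted probability measure still has mass
  one.\<close>

lemma nn_integral_exp_gauss:
  assumes \<sigma>: "\<sigma> > 0"
  shows "(\<integral>\<^sup>+x. ennreal (exp (c * x)) \<partial>gauss \<sigma>) = ennreal (exp (c\<^sup>2 * \<sigma>\<^sup>2 / 2))"
proof -
  interpret prob_space "gauss \<sigma>" by (rule prob_space_gauss[OF \<sigma>])
  define m where "m = c * \<sigma>\<^sup>2"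
  have "(\<integral>\<^sup>+x. ennreal (exp (c * x)) \<partial>gauss \<sigma>) =
      (\<integral>\<^sup>+x. ennreal (exp (c\<^sup>2 * \<sigma>\<^sup>2 / 2)) * ennreal (exp (m * x / \<sigma>\<^sup>2 - m\<^sup>2 / (2 * \<sigma>\<^sup>2))) \<partial>gauss \<sigma>)"
  proof (rule nn_integral_cong)
    fix x
    have "exp (c * x) = exp (c\<^sup>2 * \<sigma>\<^sup>2 / 2 + (m * x / \<sigma>\<^sup>2 - m\<^sup>2 / (2 * \<sigma>\<^sup>2)))"
      using \<sigma> by (intro arg_cong[where f=exp]) (simp add: m_def field_simps power2_eq_square)
    then show "ennreal (exp (c * x)) = ennreal (exp (c\<^sup>2 * \<sigma>\<^sup>2 / 2)) *
        ennreal (exp (m * x / \<sigma>\<^sup>2 - m\<^sup>2 / (2 * \<sigma>\<^sup>2)))"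
      by (simp add: exp_add ennreal_mult)
  qed
  also have "\<dots> = ennreal (exp (c\<^sup>2 * \<sigma>\<^sup>2 / 2)) *
      emeasure (density (gauss \<sigma>) (\<lambda>x. ennreal (exp (m * x / \<sigma>\<^sup>2 - m\<^sup>2 / (2 * \<sigma>\<^sup>2))))) UNIV"
    by (subst nn_integral_cmult) (auto simp: emeasure_density)
  also have "\<dots> = ennreal (exp (c\<^sup>2 * \<sigma>\<^sup>2 / 2)) * emeasure (distr (gauss \<sigma>) borel (\<lambda>x. x + m)) UNIV"
    by (simp add: distr_gauss_shift[OF \<sigma>])
  also have "\<dots> = ennreal (exp (c\<^sup>2 * \<sigma>\<^sup>2 / 2))"
    using emeasure_space_1 by (simp add: emeasure_distr)
  finally show ?thesis .
qed

text \<open>The factor turns the exponent - x^2 / 2 into - (1 - s) x^2 / 2, that of a centred normal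
  law of variance \<tau>^2 = 1 / (1 - s). The mismatch of normalising constants is \<tau>.\<close>

lemma nn_integral_exp_square_gauss:
  assumes "s \<ge> 0" "s < 1"
  shows "(\<integral>\<^sup>+x. ennreal (exp (s * x\<^sup>2 / 2)) \<partial>gauss 1) = ennreal (1 / sqrt (1 - s))"
proof -
  define \<tau> where "\<tau> = 1 / sqrt (1 - s)"
  have \<tau>: "\<tau> > 0" "\<tau>\<^sup>2 = 1 / (1 - s)" using assms by (auto simp: \<tau>_def power_divide)
  have eq: "std_normal_density x * exp (s * x\<^sup>2 / 2) = \<tau> * normal_density 0 \<tau> x" for x
  proof -
    have "\<tau> / sqrt (2 * pi * \<tau>\<^sup>2) = 1 / sqrt (2 * pi)"
      using \<tau>(1) by (simp add: real_sqrt_mult)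
    moreover have "exp (- x\<^sup>2 / 2) * exp (s * x\<^sup>2 / 2) = exp (- x\<^sup>2 / (2 * \<tau>\<^sup>2))"
      unfolding exp_add[symmetric] \<tau>(2) by (simp add: field_simps)
    ultimately have "1 / sqrt (2 * pi) * (exp (- x\<^sup>2 / 2) * exp (s * x\<^sup>2 / 2)) =
        \<tau> / sqrt (2 * pi * \<tau>\<^sup>2) * exp (- x\<^sup>2 / (2 * \<tau>\<^sup>2))"
      by simp
    then show ?thesis
      by (simp add: std_normal_density_def normal_density_def mult.assoc)
  qed
  have "(\<integral>\<^sup>+x. ennreal (exp (s * x\<^sup>2 / 2)) \<partial>gauss 1) =
      (\<integral>\<^sup>+x. ennreal \<tau> * ennreal (normal_density 0 \<tau> x) \<partial>lborel)"
    unfolding gauss_def using \<tau>(1)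
    by (subst nn_integral_density) (auto simp: ennreal_mult[symmetric] eq)
  also have "\<dots> = ennreal \<tau> * (\<integral>\<^sup>+x. ennreal (normal_density 0 \<tau> x) \<partial>lborel)"
    by (rule nn_integral_cmult) auto
  also have "(\<integral>\<^sup>+x. ennreal (normal_density 0 \<tau> x) \<partial>lborel) = 1"
    using \<tau>(1) by (subst nn_integral_eq_integral) auto
  finally show ?thesis by (simp add: \<tau>_def)
qed

lemma nn_integral_square_gauss: "(\<integral>\<^sup>+x. ennreal (x\<^sup>2) \<partial>gauss 1) = 1"
proof -
  have "(\<integral>\<^sup>+x. ennreal (x\<^sup>2) \<partial>gauss 1) = (\<integral>\<^sup>+x. ennreal (std_normal_density x * x\<^sup>2) \<partial>lborel)"
    unfolding gauss_def by (subst nn_integral_density) (auto simp: ennreal_mult)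
  also have "\<dots> = ennreal (\<integral>x. std_normal_density x * x\<^sup>2 \<partial>lborel)"
    by (intro nn_integral_eq_integral integrable_std_normal_moment) auto
  also have "(\<integral>x. std_normal_density x * x\<^sup>2 \<partial>lborel) = 1"
    using integral_std_normal_moment_even[of 1] by (simp add: fact_numeral)
  finally show ?thesis by simp
qed

lemma product_sigma_finite_gauss:
  "(\<And>i. \<sigma> i > 0) \<Longrightarrow> product_sigma_finite (\<lambda>i. gauss (\<sigma> i))"
  by (simp add: product_sigma_finite_def prob_space_imp_sigma_finite prob_space_gauss)

lemma distr_PiM_gauss_shift:
  assumes \<sigma>: "\<And>i. \<sigma> i > 0" and I: "finite I"
  shows "distr (PiM I (\<lambda>i. gauss (\<sigma> i))) (PiM I (\<lambda>_. borel)) (\<lambda>w. \<lambda>i\<in>I. w i + m i) =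
    density (PiM I (\<lambda>i. gauss (\<sigma> i)))
      (\<lambda>w. \<Prod>i\<in>I. ennreal (exp (m i * w i / (\<sigma> i)\<^sup>2 - (m i)\<^sup>2 / (2 * (\<sigma> i)\<^sup>2))))"
    (is "_ = density _ (\<lambda>w. \<Prod>i\<in>I. ?f i (w i))")
proof -
  have ps: "prob_space (distr (gauss (\<sigma> i)) borel (\<lambda>x. x + m i))" for i
    by (intro prob_space.prob_space_distr prob_space_gauss \<sigma>) auto
  have "distr (PiM I (\<lambda>i. gauss (\<sigma> i))) (PiM I (\<lambda>_. borel)) (\<lambda>w. \<lambda>i\<in>I. w i + m i) =
      PiM I (\<lambda>i. distr (gauss (\<sigma> i)) borel (\<lambda>x. x + m i))"
    using ps by (intro distr_PiM_pointwise product_sigma_finite_gauss \<sigma> I)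
      (auto simp: product_sigma_finite_def prob_space_imp_sigma_finite)
  also have "\<dots> = PiM I (\<lambda>i. density (gauss (\<sigma> i)) (?f i))"
    by (simp add: distr_gauss_shift[OF \<sigma>])
  also have "\<dots> = density (PiM I (\<lambda>i. gauss (\<sigma> i))) (\<lambda>w. \<Prod>i\<in>I. ?f i (w i))"
    using ps by (intro density_PiM[symmetric] product_sigma_finite_gauss \<sigma> I)
      (auto simp: product_sigma_finite_def prob_space_imp_sigma_finite distr_gauss_shift[OF \<sigma>])
  finally show ?thesis .
qed

text \<open>Under the product of two Cameron-Martin densities the linear terms add up, and their
  generating function yields (m + m')^2 / (2 \<sigma>^2). The squares cancel against the two
  normalisations, so only the cross term survives.\<close>

lemma nn_integral_shift_density_mult:
  assumes \<sigma>: "\<And>i. \<sigma> i > 0" and I: "finite I"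
  shows "(\<integral>\<^sup>+w. (\<Prod>i\<in>I. ennreal (exp (m i * w i / (\<sigma> i)\<^sup>2 - (m i)\<^sup>2 / (2 * (\<sigma> i)\<^sup>2)))) *
      (\<Prod>i\<in>I. ennreal (exp (m' i * w i / (\<sigma> i)\<^sup>2 - (m' i)\<^sup>2 / (2 * (\<sigma> i)\<^sup>2)))) \<partial>PiM I (\<lambda>i. gauss (\<sigma> i))) =
    ennreal (exp (\<Sum>i\<in>I. m i * m' i / (\<sigma> i)\<^sup>2))"
proof -
  interpret product_sigma_finite "\<lambda>i. gauss (\<sigma> i)"
    by (rule product_sigma_finite_gauss[OF \<sigma>])
  let ?c = "\<lambda>i. - ((m i)\<^sup>2 + (m' i)\<^sup>2) / (2 * (\<sigma> i)\<^sup>2)" and ?d = "\<lambda>i. (m i + m' i) / (\<sigma> i)\<^sup>2"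
  let ?f = "\<lambda>i x. ennreal (exp (?c i)) * ennreal (exp (?d i * x))"
  have "exp (m i * x / (\<sigma> i)\<^sup>2 - (m i)\<^sup>2 / (2 * (\<sigma> i)\<^sup>2)) * exp (m' i * x / (\<sigma> i)\<^sup>2 - (m' i)\<^sup>2 / (2 * (\<sigma> i)\<^sup>2))
      = exp (?c i) * exp (?d i * x)" for i x
    unfolding exp_add[symmetric] using \<sigma>[of i]
    by (intro arg_cong[where f=exp]) (simp add: field_simps power2_eq_square)
  then have "(\<integral>\<^sup>+w. (\<Prod>i\<in>I. ennreal (exp (m i * w i / (\<sigma> i)\<^sup>2 - (m i)\<^sup>2 / (2 * (\<sigma> i)\<^sup>2)))) *
      (\<Prod>i\<in>I. ennreal (exp (m' i * w i / (\<sigma> i)\<^sup>2 - (m' i)\<^sup>2 / (2 * (\<sigma> i)\<^sup>2)))) \<partial>PiM I (\<lambda>i. gauss (\<sigma> i))) =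
      (\<integral>\<^sup>+w. (\<Prod>i\<in>I. ?f i (w i)) \<partial>PiM I (\<lambda>i. gauss (\<sigma> i)))"
    by (simp add: prod.distrib[symmetric] ennreal_mult[symmetric])
  also have "\<dots> = (\<Prod>i\<in>I. integral\<^sup>N (gauss (\<sigma> i)) (?f i))"
    by (intro product_nn_integral_prod I) simp
  also have "\<dots> = (\<Prod>i\<in>I. ennreal (exp (m i * m' i / (\<sigma> i)\<^sup>2)))"
  proof (rule prod.cong[OF refl])
    fix i
    have "integral\<^sup>N (gauss (\<sigma> i)) (?f i) = ennreal (exp (?c i) * exp ((?d i)\<^sup>2 * (\<sigma> i)\<^sup>2 / 2))"
      by (subst nn_integral_cmult) (simp_all only: nn_integral_exp_gauss[OF \<sigma>] ennreal_mult exp_ge_zero, measurable)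
    also have "exp (?c i) * exp ((?d i)\<^sup>2 * (\<sigma> i)\<^sup>2 / 2) = exp (m i * m' i / (\<sigma> i)\<^sup>2)"
      unfolding exp_add[symmetric] using \<sigma>[of i]
      by (intro arg_cong[where f=exp]) (simp add: field_simps power2_eq_square)
    finally show "integral\<^sup>N (gauss (\<sigma> i)) (?f i) = ennreal (exp (m i * m' i / (\<sigma> i)\<^sup>2))" .
  qed
  finally show ?thesis
    by (simp add: prod_ennreal exp_sum I)
qed

subsection \<open>Polar coordinates\<close>

abbreviation leb :: "nat \<Rightarrow> (nat \<Rightarrow> real) measure" where
  "leb n \<equiv> PiM {..<n} (\<lambda>_. lborel)"

abbreviation nrm :: "nat \<Rightarrow> (nat \<Rightarrow> real) \<Rightarrow> real" where
  "nrm n z \<equiv> L2_set z {..<n}"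

abbreviation dir :: "nat \<Rightarrow> (nat \<Rightarrow> real) \<Rightarrow> nat \<Rightarrow> real" where
  "dir n z \<equiv> \<lambda>i\<in>{..<n}. z i / nrm n z"

lemma measurable_leb_cong: "leb n \<rightarrow>\<^sub>M N = vec_space n \<rightarrow>\<^sub>M N"
  by (intro measurable_cong_sets sets_PiM_lborel refl)

lemma measurable_lebI: "f \<in> vec_space n \<rightarrow>\<^sub>M N \<Longrightarrow> f \<in> leb n \<rightarrow>\<^sub>M N"
  by (simp add: measurable_leb_cong)

lemma nrm_scale: "c \<ge> 0 \<Longrightarrow> nrm n (\<lambda>i\<in>{..<n}. c * z i) = c * nrm n z"
  by (subst L2_set_right_distrib) (auto intro!: L2_set_cong)

lemma dir_scale: "c > 0 \<Longrightarrow> dir n (\<lambda>i\<in>{..<n}. c * z i) = dir n z"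
  using nrm_scale[where c=c and n=n and z=z] by (auto simp: fun_eq_iff)

text \<open>Only an inequality, since x / 0 = 0 makes the direction of the zero vector zero.\<close>

lemma nrm_dir_le_1: "nrm n (dir n z) \<le> 1"
proof -
  have "nrm n (dir n z) = nrm n (\<lambda>i. z i * (1 / nrm n z))"
    by (intro L2_set_cong) auto
  also have "\<dots> = nrm n z * (1 / nrm n z)"
    by (rule L2_set_left_distrib[symmetric]) simp
  finally show ?thesis by simp
qed

text \<open>Dilation by 1 / c carries the ball of radius c to the unit ball, fixes \<open>G\<close>
  by homogeneity of degree zero, and has Jacobian \<open>c ^ n\<close>. Open balls are used because
  the half-lines \<open>{..<c}\<close> will serve as a generator of the Borel sets.\<close>

lemma nn_integral_leb_ball:
  assumes [measurable]: "G \<in> borel_measurable (vec_space n)"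
    and hom: "\<And>c z. c > 0 \<Longrightarrow> G (\<lambda>i\<in>{..<n}. c * z i) = G z" and "c > 0"
  shows "(\<integral>\<^sup>+z. G z * indicator {..<c} (nrm n z) \<partial>leb n) =
    ennreal c ^ n * (\<integral>\<^sup>+z. G z * indicator {..<1} (nrm n z) \<partial>leb n)"
proof -
  let ?f = "\<lambda>z. G z * indicator {..<1} (nrm n z) :: ennreal"
  have f[measurable]: "?f \<in> borel_measurable (vec_space n)" by measurable
  have s: "(\<lambda>z. \<lambda>i\<in>{..<n}. 1 / c * z i) \<in> leb n \<rightarrow>\<^sub>M vec_space n"
    by (intro measurable_lebI) measurable
  have "(\<integral>\<^sup>+z. G z * indicator {..<c} (nrm n z) \<partial>leb n) =
      (\<integral>\<^sup>+z. ?f (\<lambda>i\<in>{..<n}. 1 / c * z i) \<partial>leb n)"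
  proof (rule nn_integral_cong)
    fix z
    have "nrm n (\<lambda>i\<in>{..<n}. 1 / c * z i) = 1 / c * nrm n z"
      using \<open>c > 0\<close> by (intro nrm_scale) auto
    moreover have "G (\<lambda>i\<in>{..<n}. 1 / c * z i) = G z"
      using \<open>c > 0\<close> by (intro hom) auto
    ultimately show "G z * indicator {..<c} (nrm n z) = ?f (\<lambda>i\<in>{..<n}. 1 / c * z i)"
      using \<open>c > 0\<close> by (auto simp: indicator_def)
  qed
  also have "\<dots> = integral\<^sup>N (distr (leb n) (vec_space n) (\<lambda>z. \<lambda>i\<in>{..<n}. 1 / c * z i)) ?f"
    using f by (intro nn_integral_distr[OF s, symmetric]) simp
  also have "\<dots> = (\<integral>\<^sup>+z. ennreal c ^ n * ?f z \<partial>leb n)"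
    using \<open>c > 0\<close> by (subst distr_PiM_lborel_scale) (auto intro!: nn_integral_density measurable_lebI)
  also have "\<dots> = ennreal c ^ n * (\<integral>\<^sup>+z. ?f z \<partial>leb n)"
    by (intro nn_integral_cmult measurable_lebI f)
  finally show ?thesis .
qed

lemma nn_integral_leb_open_ball:
  shows "(\<integral>\<^sup>+z. indicator {..<1} (nrm n z) \<partial>leb n) \<noteq> 0"
    and "(\<integral>\<^sup>+z. indicator {..<1} (nrm n z) \<partial>leb n) \<noteq> (\<infinity>::ennreal)"
proof -
  have m: "unit_ball n \<in> sets (leb n)"
    by (simp add: sets_PiM_lborel)
  let ?B = "\<lambda>z. indicator (unit_ball n) z :: ennreal"
  \<comment> \<open>The prior is built on the closed ball, the scaling argument on open ones. The
    closed unit ball fits into the open ball of radius 2, which has \<open>2 ^ n\<close> times the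
    open unit volume.\<close>
  have "(\<integral>\<^sup>+z. ?B z \<partial>leb n) \<le> (\<integral>\<^sup>+z. indicator {..<2} (nrm n z) \<partial>leb n)"
    by (intro nn_integral_mono) (auto simp: unit_ball_def indicator_def)
  also have "\<dots> = 2 ^ n * (\<integral>\<^sup>+z. indicator {..<1} (nrm n z) \<partial>leb n)"
    using nn_integral_leb_ball[of "\<lambda>_. 1" n 2] by simp
  finally show "(\<integral>\<^sup>+z. indicator {..<1} (nrm n z) \<partial>leb n) \<noteq> (0::ennreal)"
    using emeasure_unit_ball[of n] m by (auto simp del: nn_integral_indicator simp flip: nn_integral_indicator)
  have "(\<integral>\<^sup>+z. indicator {..<1} (nrm n z) \<partial>leb n) \<le> (\<integral>\<^sup>+z. ?B z \<partial>leb n)"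
    by (intro nn_integral_mono) (auto simp: unit_ball_def indicator_def space_PiM_lborel)
  then show "(\<integral>\<^sup>+z. indicator {..<1} (nrm n z) \<partial>leb n) \<noteq> (\<infinity>::ennreal)"
    using emeasure_unit_ball[of n] m by (auto simp: top_unique)
qed

text \<open>For fixed \<open>G\<close>, the pushforward of \<open>G(z) dz\<close> under the norm is determined up to a scalar
  by homogeneity: it gives mass proportional to $c^n$ to the ball of radius \<open>c\<close>.\<close>

lemma nn_integral_leb_radial:
  fixes G :: "(nat \<Rightarrow> real) \<Rightarrow> ennreal"
  assumes G[measurable]: "G \<in> borel_measurable (vec_space n)"
    and hom: "\<And>c z. c > 0 \<Longrightarrow> G (\<lambda>i\<in>{..<n}. c * z i) = G z"
    and bdd: "\<And>z. G z \<le> K" "K \<noteq> \<infinity>"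
    and \<phi>[measurable]: "\<phi> \<in> borel_measurable borel"
  shows "(\<integral>\<^sup>+z. indicator {..<1} (nrm n z) \<partial>leb n) * (\<integral>\<^sup>+z. G z * \<phi> (nrm n z) \<partial>leb n) =
    (\<integral>\<^sup>+z. G z * indicator {..<1} (nrm n z) \<partial>leb n) * (\<integral>\<^sup>+z. \<phi> (nrm n z) \<partial>leb n)"
proof -
  let ?V = "\<integral>\<^sup>+z. indicator {..<1} (nrm n z) \<partial>leb n :: ennreal"
  let ?g = "\<integral>\<^sup>+z. G z * indicator {..<1} (nrm n z) \<partial>leb n"
  \<comment> \<open>The law of the norm under the weight \<open>H\<close>, multiplied by a constant
    \<open>k\<close>. Choosing \<open>k\<close> crosswise, as the mass that the other weight gives
    to the unit ball, equalises the two measures without any division.\<close>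
  define \<nu> where "\<nu> H k = density (distr (density (leb n) H) borel (nrm n)) (\<lambda>_. k)"
    for H :: "(nat \<Rightarrow> real) \<Rightarrow> ennreal" and k :: ennreal
  have nu: "integral\<^sup>N (\<nu> H k) \<psi> = k * (\<integral>\<^sup>+z. H z * \<psi> (nrm n z) \<partial>leb n)"
    if [measurable]: "H \<in> borel_measurable (vec_space n)" "\<psi> \<in> borel_measurable borel" for H k \<psi>
  proof -
    have "integral\<^sup>N (\<nu> H k) \<psi> = k * integral\<^sup>N (distr (density (leb n) H) borel (nrm n)) \<psi>"
      unfolding \<nu>_def by (subst nn_integral_density) (auto intro!: nn_integral_cmult)
    also have "integral\<^sup>N (distr (density (leb n) H) borel (nrm n)) \<psi> =
        (\<integral>\<^sup>+z. \<psi> (nrm n z) \<partial>density (leb n) H)"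
      by (intro nn_integral_distr) (simp_all add: measurable_leb_cong)
    also have "\<dots> = (\<integral>\<^sup>+z. H z * \<psi> (nrm n z) \<partial>leb n)"
      by (intro nn_integral_density) (simp_all add: measurable_leb_cong)
    finally show ?thesis .
  qed
  have em: "emeasure (\<nu> H k) {..<c} = k * (\<integral>\<^sup>+z. H z * indicator {..<c} (nrm n z) \<partial>leb n)"
    if "H \<in> borel_measurable (vec_space n)" for H k c
    using nu[OF that, of "indicator {..<c}" k] by (subst nn_integral_indicator[symmetric]) (auto simp: \<nu>_def)
  have eq: "emeasure (\<nu> G ?V) {..<c} = emeasure (\<nu> (\<lambda>_. 1) ?g) {..<c}" for c
  proof (cases "c > 0")
    case True
    then show ?thesis
      using nn_integral_leb_ball[OF G hom True] nn_integral_leb_ball[of "\<lambda>_. 1" n c]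
      by (simp add: em mult_ac)
  next
    case False
    then have "indicator {..<c} (nrm n z) = (0::ennreal)" for z
      using order_trans[of c 0 "nrm n z"] by (auto simp: indicator_def)
    then show ?thesis by (simp add: em)
  qed
  have "\<nu> G ?V = \<nu> (\<lambda>_. 1) ?g"
  proof (rule measure_eqI_generator_eq[where E="range lessThan" and \<Omega>=UNIV and A="\<lambda>i. {..<real i}"])
    show "Int_stable (range (lessThan :: real \<Rightarrow> _))"
      unfolding Int_stable_def
    proof safe
      fix a b :: real
      have "{..<a} \<inter> {..<b} = {..<min a b}" by auto
      then show "{..<a} \<inter> {..<b} \<in> range lessThan" by blast
    qed
    show "sets (\<nu> G ?V) = sigma_sets UNIV (range lessThan)"
      "sets (\<nu> (\<lambda>_. 1) ?g) = sigma_sets UNIV (range lessThan)"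
      by (simp_all add: \<nu>_def borel_Iio)
    show "(\<Union>i. {..<real i}) = UNIV"
      using reals_Archimedean2 by auto
    \<comment> \<open>Uniqueness from a generator needs finite mass on the exhausting balls; the
      bound \<open>K\<close> on \<open>G\<close> supplies it.\<close>
    have "?g \<le> (\<integral>\<^sup>+z. K * indicator {..<1} (nrm n z) \<partial>leb n)"
      by (intro nn_integral_mono mult_right_mono bdd) auto
    also have "\<dots> = K * ?V"
      by (intro nn_integral_cmult measurable_lebI) measurable
    finally have "?g \<noteq> \<infinity>"
      using nn_integral_leb_open_ball(2)[of n] bdd(2) by (auto simp: top_unique ennreal_mult_eq_top_iff)
    moreover have "(\<integral>\<^sup>+z. G z * indicator {..<real i} (nrm n z) \<partial>leb n) = ennreal (real i) ^ n * ?g"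
      if "i > 0" for i
      using that by (intro nn_integral_leb_ball G hom) auto
    moreover have "indicator {..<real 0} (nrm n z) = (0::ennreal)" for z
      by (auto simp: indicator_def not_less)
    ultimately show "emeasure (\<nu> G ?V) {..<real i} \<noteq> \<infinity>" for i
      using nn_integral_leb_open_ball(2)[of n]
      by (cases "i = 0") (auto simp: em ennreal_mult_eq_top_iff power_eq_top_ennreal)
  qed (auto simp: eq)
  then have "integral\<^sup>N (\<nu> G ?V) \<phi> = integral\<^sup>N (\<nu> (\<lambda>_. 1) ?g) \<phi>" by simp
  then show ?thesis by (simp add: nu)
qed

text \<open>The radial identity is used twice. With the indicator of \<open>{..1}\<close> it shows
  that the expectation of \<open>F\<close> under the prior is \<open>?g / ?V\<close>, whichever kind
  of ball is taken; with \<open>\<phi>\<close> it then gives the factorisation.\<close>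

lemma polar_leb:
  fixes F :: "(nat \<Rightarrow> real) \<Rightarrow> ennreal"
  assumes F[measurable]: "F \<in> borel_measurable (vec_space n)"
    and bdd: "\<And>z. F (dir n z) \<le> K" "K \<noteq> \<infinity>"
    and \<phi>[measurable]: "\<phi> \<in> borel_measurable borel"
  shows "(\<integral>\<^sup>+z. F (dir n z) * \<phi> (nrm n z) \<partial>leb n) =
    (\<integral>\<^sup>+x. F x \<partial>spherical_prior n) * (\<integral>\<^sup>+z. \<phi> (nrm n z) \<partial>leb n)"
proof -
  let ?V = "\<integral>\<^sup>+z. indicator {..<1} (nrm n z) \<partial>leb n :: ennreal"
  let ?g = "\<integral>\<^sup>+z. F (dir n z) * indicator {..<1} (nrm n z) \<partial>leb n"
  let ?b = "\<integral>\<^sup>+z. F (dir n z) * indicator {..1} (nrm n z) \<partial>leb n"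
  note V = nn_integral_leb_open_ball[of n]
  have FD[measurable]: "(\<lambda>z. F (dir n z)) \<in> borel_measurable (vec_space n)"
    by (rule measurable_compose[OF measurable_direction F])
  have hom: "F (dir n (\<lambda>i\<in>{..<n}. c * z i)) = F (dir n z)" if "c > 0" for c z
    by (simp only: dir_scale[OF that])
  have rad: "?V * (\<integral>\<^sup>+z. F (dir n z) * \<psi> (nrm n z) \<partial>leb n) = ?g * (\<integral>\<^sup>+z. \<psi> (nrm n z) \<partial>leb n)"
    if "\<psi> \<in> borel_measurable borel" for \<psi>
    by (rule nn_integral_leb_radial[OF FD hom bdd that])
  have m: "unit_ball n \<in> sets (leb n)"
    by (simp add: sets_PiM_lborel)
  have ball: "indicator {..1} (nrm n z) = (indicator (unit_ball n) z :: ennreal)" if "z \<in> space (leb n)" for z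
    using that by (auto simp: unit_ball_def indicator_def space_PiM_lborel)
  have B: "(\<integral>\<^sup>+z. indicator {..1} (nrm n z) \<partial>leb n) = emeasure (leb n) (unit_ball n)"
    unfolding nn_integral_indicator[OF m, symmetric] by (intro nn_integral_cong ball)
  have "(\<integral>\<^sup>+x. F x \<partial>spherical_prior n) = (\<integral>\<^sup>+z. F (dir n z) \<partial>uniform_measure (leb n) (unit_ball n))"
    unfolding spherical_prior_def by (intro nn_integral_distr measurable_direction_uniform) simp
  also have "\<dots> = (\<integral>\<^sup>+z. F (dir n z) * indicator (unit_ball n) z \<partial>leb n) / emeasure (leb n) (unit_ball n)"
    by (intro nn_integral_uniform_measure m) (simp add: measurable_leb_cong)
  also have "(\<integral>\<^sup>+z. F (dir n z) * indicator (unit_ball n) z \<partial>leb n) = ?b"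
    by (intro nn_integral_cong) (simp add: ball)
  finally have E: "(\<integral>\<^sup>+x. F x \<partial>spherical_prior n) * emeasure (leb n) (unit_ball n) = ?b"
    using emeasure_unit_ball[of n] by (simp add: ennreal_divide_times ennreal_divide_self less_top)
  have "?V * ((\<integral>\<^sup>+x. F x \<partial>spherical_prior n) * emeasure (leb n) (unit_ball n)) =
      ?g * emeasure (leb n) (unit_ball n)"
    unfolding E using rad[of "indicator {..1}"] by (simp add: B)
  \<comment> \<open>The closed ball has positive finite volume, so this common factor may be
    cancelled.\<close>
  then have "emeasure (leb n) (unit_ball n) * (?V * (\<integral>\<^sup>+x. F x \<partial>spherical_prior n)) =
      emeasure (leb n) (unit_ball n) * ?g"
    by (simp only: mult_ac)
  then have "?V * (\<integral>\<^sup>+x. F x \<partial>spherical_prior n) = ?g"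
    using emeasure_unit_ball[of n] by (auto simp only: ennreal_mult_cancel_left infinity_ennreal_def)
  then have "?V * (\<integral>\<^sup>+z. F (dir n z) * \<phi> (nrm n z) \<partial>leb n) =
      ?V * ((\<integral>\<^sup>+x. F x \<partial>spherical_prior n) * (\<integral>\<^sup>+z. \<phi> (nrm n z) \<partial>leb n))"
    using rad[OF \<phi>] by (simp add: mult.assoc[symmetric])
  then show ?thesis
    using V by (simp add: ennreal_mult_cancel_left)
qed

section \<open>Gaussian vectors in polar coordinates\<close>

abbreviation gaussv :: "nat \<Rightarrow> (nat \<Rightarrow> real) measure" where
  "gaussv n \<equiv> PiM {..<n} (\<lambda>_. gauss 1)"

lemma gaussv_eq_density:
  "gaussv n = density (leb n) (\<lambda>z. ennreal ((1 / sqrt (2 * pi)) ^ n * exp (- (nrm n z)\<^sup>2 / 2)))"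
proof -
  have "gaussv n = density (leb n) (\<lambda>z. \<Prod>i<n. ennreal (std_normal_density (z i)))"
    unfolding gauss_def
    by (intro density_PiM[symmetric])
      (auto simp: product_sigma_finite_def sigma_finite_lborel prob_space_imp_sigma_finite prob_space_normal_density)
  also have "(\<lambda>z. \<Prod>i<n. ennreal (std_normal_density (z i))) =
      (\<lambda>z. ennreal ((1 / sqrt (2 * pi)) ^ n * exp (- (nrm n z)\<^sup>2 / 2)))"
  proof
    fix z
    have "(\<Prod>i<n. std_normal_density (z i)) = (1 / sqrt (2 * pi)) ^ n * exp (\<Sum>i<n. - (z i)\<^sup>2 / 2)"
      by (simp add: std_normal_density_def exp_sum prod_dividef power_one_over)
    also have "(\<Sum>i<n. - (z i)\<^sup>2 / 2) = - (nrm n z)\<^sup>2 / 2"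
      by (simp add: L2_set_def sum_nonneg sum_negf sum_divide_distrib)
    finally show "(\<Prod>i<n. ennreal (std_normal_density (z i))) =
        ennreal ((1 / sqrt (2 * pi)) ^ n * exp (- (nrm n z)\<^sup>2 / 2))"
      by (simp add: prod_ennreal)
  qed
  finally show ?thesis .
qed

lemma prob_space_gaussv: "prob_space (gaussv n)"
  by (intro prob_space_PiM prob_space_gauss) auto

text \<open>The Gaussian density depends on the norm only, so it can be absorbed into the radial
  factor of the Lebesgue version.\<close>

lemma polar_gaussv:
  fixes F :: "(nat \<Rightarrow> real) \<Rightarrow> ennreal"
  assumes F[measurable]: "F \<in> borel_measurable (vec_space n)"
    and bdd: "\<And>z. F (dir n z) \<le> K" "K \<noteq> \<infinity>"
    and \<phi>[measurable]: "\<phi> \<in> borel_measurable borel"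
  shows "(\<integral>\<^sup>+z. F (dir n z) * \<phi> (nrm n z) \<partial>gaussv n) =
    (\<integral>\<^sup>+x. F x \<partial>spherical_prior n) * (\<integral>\<^sup>+z. \<phi> (nrm n z) \<partial>gaussv n)"
proof -
  define \<rho> where "\<rho> r = ennreal ((1 / sqrt (2 * pi)) ^ n * exp (- r\<^sup>2 / 2))" for r
  have [measurable]: "\<rho> \<in> borel_measurable borel"
    unfolding \<rho>_def by measurable
  have [measurable]: "(\<lambda>z. F (dir n z)) \<in> borel_measurable (vec_space n)"
    by (rule measurable_compose[OF measurable_direction F])
  have int: "integral\<^sup>N (gaussv n) f = (\<integral>\<^sup>+z. \<rho> (nrm n z) * f z \<partial>leb n)"
    if [measurable]: "f \<in> borel_measurable (vec_space n)" for f
    unfolding gaussv_eq_density \<rho>_def[symmetric]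
    by (intro nn_integral_density) (simp_all add: measurable_leb_cong)
  have "(\<integral>\<^sup>+z. F (dir n z) * \<phi> (nrm n z) \<partial>gaussv n) =
      (\<integral>\<^sup>+z. F (dir n z) * (\<rho> (nrm n z) * \<phi> (nrm n z)) \<partial>leb n)"
    by (simp add: int mult_ac)
  also have "\<dots> = (\<integral>\<^sup>+x. F x \<partial>spherical_prior n) * (\<integral>\<^sup>+z. \<rho> (nrm n z) * \<phi> (nrm n z) \<partial>leb n)"
    by (rule polar_leb[OF F bdd]) measurable
  also have "(\<integral>\<^sup>+z. \<rho> (nrm n z) * \<phi> (nrm n z) \<partial>leb n) = (\<integral>\<^sup>+z. \<phi> (nrm n z) \<partial>gaussv n)"
    by (simp add: int)
  finally show ?thesis .
qed

lemma nn_integral_nrm_gaussv: "(\<integral>\<^sup>+z. ennreal ((nrm n z)\<^sup>2) \<partial>gaussv n) = of_nat n"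
proof -
  have c: "(\<integral>\<^sup>+z. ennreal ((z i)\<^sup>2) \<partial>gaussv n) = 1" if i: "i < n" for i
  proof -
    have "(\<integral>\<^sup>+z. ennreal ((z i)\<^sup>2) \<partial>gaussv n) = (\<integral>\<^sup>+x. ennreal (x\<^sup>2) \<partial>distr (gaussv n) (gauss 1) (\<lambda>z. z i))"
      using i by (subst nn_integral_distr) (auto intro!: measurable_component_singleton)
    also have "distr (gaussv n) (gauss 1) (\<lambda>z. z i) = gauss 1"
      using i by (intro distr_PiM_component prob_space_gauss) auto
    finally show ?thesis by (simp add: nn_integral_square_gauss)
  qed
  have "(\<integral>\<^sup>+z. ennreal ((nrm n z)\<^sup>2) \<partial>gaussv n) = (\<integral>\<^sup>+z. (\<Sum>i<n. ennreal ((z i)\<^sup>2)) \<partial>gaussv n)"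
    by (simp add: L2_set_def sum_nonneg)
  also have "\<dots> = (\<Sum>i<n. \<integral>\<^sup>+z. ennreal ((z i)\<^sup>2) \<partial>gaussv n)"
    by (intro nn_integral_sum) measurable
  also have "\<dots> = of_nat n" by (simp add: c)
  finally show ?thesis .
qed

section \<open>Exponential moments of squared inner products\<close>

lemma nn_integral_exp_inner_square_gaussv:
  assumes u: "nrm n u = 1" and s: "0 \<le> s" "s < 1"
  shows "(\<integral>\<^sup>+z. ennreal (exp (s * (\<Sum>i<n. z i * u i)\<^sup>2 / 2)) \<partial>gaussv n) = ennreal (1 / sqrt (1 - s))"
proof -
  interpret G: prob_space "gauss 1" by (rule prob_space_gauss) simp
  interpret V: prob_space "gaussv n" by (rule prob_space_gaussv)
  interpret pair_sigma_finite "gaussv n" "gauss 1" ..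
  interpret product_sigma_finite "\<lambda>_::nat. gauss 1" by (rule product_sigma_finite_gauss) simp
  txt \<open>An auxiliary Gaussian \<open>g\<close> linearises the square (Hubbard-Stratonovich), so that the
    integrand factorises over the coordinates.\<close>
  have "(\<integral>\<^sup>+z. ennreal (exp (s * (\<Sum>i<n. z i * u i)\<^sup>2 / 2)) \<partial>gaussv n) =
      (\<integral>\<^sup>+z. \<integral>\<^sup>+g. ennreal (exp (sqrt s * (\<Sum>i<n. z i * u i) * g)) \<partial>gauss 1 \<partial>gaussv n)"
    using s by (simp add: nn_integral_exp_gauss power_mult_distrib)
  also have "\<dots> = (\<integral>\<^sup>+g. \<integral>\<^sup>+z. ennreal (exp (sqrt s * (\<Sum>i<n. z i * u i) * g)) \<partial>gaussv n \<partial>gauss 1)"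
    by (rule Fubini'[symmetric]) measurable
  also have "\<dots> = (\<integral>\<^sup>+g. ennreal (exp (s * g\<^sup>2 / 2)) \<partial>gauss 1)"
  proof (rule nn_integral_cong)
    fix g
    have "(\<integral>\<^sup>+z. ennreal (exp (sqrt s * (\<Sum>i<n. z i * u i) * g)) \<partial>gaussv n) =
        (\<integral>\<^sup>+z. (\<Prod>i<n. ennreal (exp (sqrt s * g * u i * z i))) \<partial>gaussv n)"
      by (simp add: prod_ennreal exp_sum[symmetric] sum_distrib_left sum_distrib_right mult_ac)
    also have "\<dots> = (\<Prod>i<n. \<integral>\<^sup>+x. ennreal (exp (sqrt s * g * u i * x)) \<partial>gauss 1)"
      by (intro product_nn_integral_prod) auto
    also have "\<dots> = (\<Prod>i<n. ennreal (exp (s * g\<^sup>2 * (u i)\<^sup>2 / 2)))"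
      using s by (simp add: nn_integral_exp_gauss power_mult_distrib)
    also have "\<dots> = ennreal (exp (s * g\<^sup>2 / 2 * (\<Sum>i<n. (u i)\<^sup>2)))"
      by (simp add: prod_ennreal exp_sum[symmetric] sum_distrib_left)
    also have "(\<Sum>i<n. (u i)\<^sup>2) = 1"
      using u by (simp add: L2_set_def)
    finally show "(\<integral>\<^sup>+z. ennreal (exp (sqrt s * (\<Sum>i<n. z i * u i) * g)) \<partial>gaussv n) =
        ennreal (exp (s * g\<^sup>2 / 2))" by simp
  qed
  also have "\<dots> = ennreal (1 / sqrt (1 - s))"
    by (rule nn_integral_exp_square_gauss[OF s])
  finally show ?thesis .
qed

text \<open>Jensen is applied conditionally on the direction, in tangent-line form, so that the
  factorised integrals of \<open>polar_gaussv\<close> replace conditional expectations. The factor n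
  in the exponent is the mean of the squared Gaussian norm.\<close>

lemma nn_integral_exp_inner_square_sphere:
  assumes u: "nrm n u = 1" and s: "0 \<le> s" "s < 1"
  shows "(\<integral>\<^sup>+x. ennreal (exp (s * n * (\<Sum>i<n. x i * u i)\<^sup>2 / 2)) \<partial>spherical_prior n)
    \<le> ennreal (1 / sqrt (1 - s))"
proof -
  have n: "n > 0" using u by (cases n) auto
  interpret S: prob_space "spherical_prior n" by (rule prob_space_spherical_prior)
  interpret V: prob_space "gaussv n" by (rule prob_space_gaussv)
  define p where "p x = s * n * (\<Sum>i<n. x i * u i)\<^sup>2 / 2" for x
  define K where "K = s * n / 2"
  have p[measurable]: "p \<in> borel_measurable (vec_space n)"
    unfolding p_def by measurable
  have p0: "0 \<le> p x" for x using s by (simp add: p_def)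
  have K0: "0 \<le> K" using s by (simp add: K_def)
  \<comment> \<open>Cauchy-Schwarz. The bound grows with n but serves only to guarantee finiteness,
    and does not enter the final estimate.\<close>
  have pK: "p x \<le> K" if "nrm n x \<le> 1" for x
  proof -
    have "\<bar>\<Sum>i<n. x i * u i\<bar> \<le> (\<Sum>i<n. \<bar>x i\<bar> * \<bar>u i\<bar>)"
      unfolding abs_mult[symmetric] by (rule sum_abs)
    also have "\<dots> \<le> nrm n x * nrm n u" by (rule L2_set_mult_ineq)
    also have "\<dots> \<le> 1" using u that by simp
    finally have "(\<Sum>i<n. x i * u i)\<^sup>2 \<le> 1" by (simp add: abs_square_le_1)
    then have "s * n * (\<Sum>i<n. x i * u i)\<^sup>2 \<le> s * n * 1"
      using s by (intro mult_left_mono) auto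
    then show ?thesis by (simp add: p_def K_def)
  qed
  let ?e = "\<lambda>x. ennreal (exp (p x))" and ?pe = "\<lambda>x. ennreal (p x * exp (p x))"
  have e_le: "?e (dir n z) \<le> ennreal (exp K)" for z
    using pK[OF nrm_dir_le_1] by (intro ennreal_leI) simp
  have pe_le: "?pe (dir n z) \<le> ennreal (K * exp K)" for z
    using pK[OF nrm_dir_le_1] p0 K0 by (intro ennreal_leI mult_mono) auto
  let ?q = "\<lambda>z. s * (\<Sum>i<n. z i * u i)\<^sup>2 / 2"
  have q: "?q z = p (dir n z) * ((nrm n z)\<^sup>2 / n)" for z
  proof (cases "nrm n z = 0")
    case True
    then show ?thesis by (simp add: L2_set_eq_0_iff)
  next
    case False
    have "(\<Sum>i<n. dir n z i * u i) = (\<Sum>i<n. z i * u i) / nrm n z"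
      by (simp add: sum_divide_distrib)
    then show ?thesis
      using False n by (simp add: p_def power_divide)
  qed
  txt \<open>This is the tangent-line inequality $e^q \ge e^p (1 + q - p)$ with
    $p = \frac{s n}{2} \langle z/\|z\|, u\rangle^2$ and $q = \frac{s}{2} \langle z, u\rangle^2 = p\,\|z\|^2/n$,
    with both sides moved so that all terms are nonnegative.\<close>
  have pt: "?e (dir n z) * 1 + ?pe (dir n z) * ennreal ((nrm n z)\<^sup>2 / n) \<le>
      ennreal (exp (?q z)) + ?pe (dir n z) * 1" for z
  proof -
    define a b where "a = p (dir n z)" and "b = ?q z"
    have "1 + (b - a) \<le> exp (b - a)" by (rule exp_ge_add_one_self)
    then have "exp a * (1 + (b - a)) \<le> exp a * exp (b - a)" by simp
    also have "exp a * exp (b - a) = exp b" by (simp add: exp_add[symmetric])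
    finally have "exp a + b * exp a \<le> exp b + a * exp a" by (simp add: algebra_simps)
    moreover have "b = a * ((nrm n z)\<^sup>2 / n)" unfolding a_def b_def by (rule q)
    ultimately have "exp a + (a * exp a) * ((nrm n z)\<^sup>2 / n) \<le> exp b + (a * exp a) * 1"
      by (simp add: mult_ac)
    moreover have "0 \<le> a * exp a" by (simp add: a_def p0)
    moreover have lin: "ennreal x + ennreal y * ennreal r = ennreal (x + y * r)"
      if "0 \<le> x" "0 \<le> y" "0 \<le> r" for x y r :: real
      using that by (simp add: ennreal_mult)
    ultimately have "ennreal (exp a) + ennreal (a * exp a) * ennreal ((nrm n z)\<^sup>2 / n) \<le>
        ennreal (exp b) + ennreal (a * exp a) * ennreal 1"
      using lin[of "exp a" "a * exp a" "(nrm n z)\<^sup>2 / n"] lin[of "exp b" "a * exp a" 1]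
        ennreal_leI[of "exp a + (a * exp a) * ((nrm n z)\<^sup>2 / n)"]
      by (metis divide_nonneg_nonneg exp_ge_zero of_nat_0_le_iff zero_le_one zero_le_power2)
    then show ?thesis
      unfolding a_def b_def by simp
  qed
  have [measurable]: "(\<lambda>z. p (dir n z)) \<in> borel_measurable (vec_space n)"
    by (rule measurable_compose[OF measurable_direction p])
  have gm: "borel_measurable (gaussv n) = borel_measurable (vec_space n)"
    by (intro measurable_cong_sets sets_PiM_cong) auto
  let ?E = "\<integral>\<^sup>+x. ?e x \<partial>spherical_prior n" and ?PE = "\<integral>\<^sup>+x. ?pe x \<partial>spherical_prior n"
  \<comment> \<open>Since nrm^2 / n has mean one, the linear terms on the two sides of the tangent
    inequality have the same integral \<open>?PE\<close>.\<close>
  have "?E + ?PE = (\<integral>\<^sup>+z. ?e (dir n z) * 1 \<partial>gaussv n) +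
      (\<integral>\<^sup>+z. ?pe (dir n z) * ennreal ((nrm n z)\<^sup>2 / n) \<partial>gaussv n)"
  proof -
    have "(\<integral>\<^sup>+z. ennreal ((nrm n z)\<^sup>2 / n) \<partial>gaussv n) = (\<integral>\<^sup>+z. ennreal ((nrm n z)\<^sup>2) / ennreal n \<partial>gaussv n)"
      using n by (simp add: divide_ennreal)
    also have "\<dots> = of_nat n / ennreal n"
      by (subst nn_integral_divide) (simp_all add: gm nn_integral_nrm_gaussv)
    also have "\<dots> = 1"
      using n by (simp add: ennreal_of_nat_eq_real_of_nat divide_ennreal)
    finally have 1: "(\<integral>\<^sup>+z. ennreal ((nrm n z)\<^sup>2 / n) \<partial>gaussv n) = 1" .
    have "(\<integral>\<^sup>+z. ?e (dir n z) * 1 \<partial>gaussv n) = ?E"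
      using polar_gaussv[of ?e n _ "\<lambda>_. 1", OF _ e_le] V.emeasure_space_1 by simp
    moreover have "(\<integral>\<^sup>+z. ?pe (dir n z) * ennreal ((nrm n z)\<^sup>2 / n) \<partial>gaussv n) = ?PE"
      using polar_gaussv[of ?pe n _ "\<lambda>r. ennreal (r\<^sup>2 / n)", OF _ pe_le] 1 by simp
    ultimately show ?thesis by simp
  qed
  also have "\<dots> = (\<integral>\<^sup>+z. ?e (dir n z) * 1 + ?pe (dir n z) * ennreal ((nrm n z)\<^sup>2 / n) \<partial>gaussv n)"
    by (intro nn_integral_add[symmetric]) (simp_all add: gm)
  also have "\<dots> \<le> (\<integral>\<^sup>+z. ennreal (exp (?q z)) + ?pe (dir n z) * 1 \<partial>gaussv n)"
    by (intro nn_integral_mono pt)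
  also have "\<dots> = (\<integral>\<^sup>+z. ennreal (exp (?q z)) \<partial>gaussv n) + (\<integral>\<^sup>+z. ?pe (dir n z) * 1 \<partial>gaussv n)"
    by (intro nn_integral_add) (simp_all add: gm)
  also have "(\<integral>\<^sup>+z. ennreal (exp (?q z)) \<partial>gaussv n) = ennreal (1 / sqrt (1 - s))"
    by (rule nn_integral_exp_inner_square_gaussv[OF u s])
  also have PE: "(\<integral>\<^sup>+z. ?pe (dir n z) * 1 \<partial>gaussv n) = ?PE"
    using polar_gaussv[of ?pe n _ "\<lambda>_. 1", OF _ pe_le] V.emeasure_space_1 by simp
  finally have le: "?E + ?PE \<le> ennreal (1 / sqrt (1 - s)) + ?PE" .
  \<comment> \<open>Finiteness of \<open>?PE\<close> is what permits cancelling it from both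
    sides.\<close>
  have "?PE \<le> (\<integral>\<^sup>+z. ennreal (K * exp K) \<partial>gaussv n)"
    unfolding PE[symmetric] using pe_le by (intro nn_integral_mono) simp
  also have "\<dots> < \<infinity>" using V.emeasure_space_1 by simp
  finally have "?PE \<noteq> top" by simp
  then have "?E \<le> ennreal (1 / sqrt (1 - s))"
    using le ennreal_add_left_cancel_le[of ?PE ?E "ennreal (1 / sqrt (1 - s))"] by (simp add: add.commute)
  then show ?thesis by (simp add: p_def)
qed

subsection \<open>The likelihood ratio\<close>

definition sd :: "nat \<times> nat \<Rightarrow> real" where
  "sd t = (if fst t = snd t then sqrt 2 else 1)"

abbreviation noise :: "nat \<Rightarrow> (nat \<times> nat \<Rightarrow> real) measure" where
  "noise n \<equiv> PiM (upper_triangle n) (\<lambda>t. gauss (sd t))"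

text \<open>The factor \<open>sqrt n\<close> undoes the division in \<open>wigner\<close>: this is
  the spike as seen by the unscaled noise.\<close>

definition spike :: "real \<Rightarrow> nat \<Rightarrow> (nat \<Rightarrow> real) \<Rightarrow> nat \<times> nat \<Rightarrow> real" where
  "spike lam n x t = sqrt n * lam * (x (fst t) * x (snd t))"

text \<open>The density of \<open>noise n\<close> shifted by the spike \<open>x\<close> with respect to \<open>noise n\<close>.\<close>

definition lik :: "real \<Rightarrow> nat \<Rightarrow> (nat \<Rightarrow> real) \<Rightarrow> (nat \<times> nat \<Rightarrow> real) \<Rightarrow> ennreal" where
  "lik lam n x w = (\<Prod>t\<in>upper_triangle n.
     ennreal (exp (spike lam n x t * w t / (sd t)\<^sup>2 - (spike lam n x t)\<^sup>2 / (2 * (sd t)\<^sup>2))))"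

text \<open>Symmetrisation from \<open>GOE\<close> and scaling from \<open>GWig\<close> fused into
  one map, along which matrix events are pulled back to the independent entries.\<close>

definition wigner :: "nat \<Rightarrow> (nat \<times> nat \<Rightarrow> real) \<Rightarrow> nat \<times> nat \<Rightarrow> real" where
  "wigner n w = (\<lambda>(i, j)\<in>{..<n} \<times> {..<n}. w (min i j, max i j) / sqrt n)"

lemma sd_pos: "sd t > 0"
  by (simp add: sd_def)

lemma prob_space_noise: "prob_space (noise n)"
  by (intro prob_space_PiM prob_space_gauss sd_pos)

lemma sets_noise: "sets (noise n) = sets (PiM (upper_triangle n) (\<lambda>_. borel))"
  by (intro sets_PiM_cong) auto

lemma noise_eq: "noise n = PiM (upper_triangle n)
    (\<lambda>(i, j). density lborel (normal_density 0 (if i = j then sqrt 2 else 1)))"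
  by (intro PiM_cong) (auto simp: gauss_def sd_def)

lemma measurable_wigner: "wigner n \<in> PiM (upper_triangle n) (\<lambda>_. borel) \<rightarrow>\<^sub>M mat_space n"
proof -
  have "(\<lambda>w. w (min i j, max i j) / sqrt n) \<in> borel_measurable (PiM (upper_triangle n) (\<lambda>_. borel))"
    if "i < n" "j < n" for i j
  proof -
    have "(min i j, max i j) \<in> upper_triangle n"
      using that by (auto simp: upper_triangle_def)
    then show ?thesis by measurable
  qed
  then show ?thesis
    unfolding wigner_def by (intro measurable_restrict) auto
qed

lemma measurable_lik:
  "case_prod (lik lam n) \<in> borel_measurable (vec_space n \<Otimes>\<^sub>M noise n)"
proof -
  have "(\<lambda>(x, w). ennreal (exp (spike lam n x t * w t / (sd t)\<^sup>2 - (spike lam n x t)\<^sup>2 / (2 * (sd t)\<^sup>2))))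
      \<in> borel_measurable (vec_space n \<Otimes>\<^sub>M noise n)" if t[measurable]: "t \<in> upper_triangle n" for t
  proof -
    have [simp]: "fst t < n" "snd t < n" using t by (auto simp: upper_triangle_def)
    show ?thesis unfolding spike_def by measurable
  qed
  then show ?thesis
    unfolding lik_def case_prod_beta by (intro borel_measurable_prod_ennreal) auto
qed

text \<open>For a fixed spike, the added rank-one matrix is a shift of the noise, and Cameron-Martin
  trades the shift for the weight \<open>lik\<close>. The remaining integral over the prior makes
  the likelihood ratio a mixture.\<close>

lemma emeasure_GWig_spherical:
  assumes A: "A \<in> sets (mat_space n)" and n: "n > 0"
  shows "emeasure (GWig lam spherical_prior n) A =
    (\<integral>\<^sup>+x. \<integral>\<^sup>+w. indicator (wigner n -` A \<inter> space (noise n)) w * lik lam n x w \<partial>noise n \<partial>spherical_prior n)"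
proof -
  interpret G: prob_space "GOE n" by (rule prob_space_GOE)
  let ?U = "spherical_prior n" and ?T = "upper_triangle n"
  let ?Y = "\<lambda>(x, W). \<lambda>(i, j)\<in>{..<n} \<times> {..<n}. lam * (x i * x j) + W (i, j) / sqrt (real n)"
  let ?sym = "\<lambda>w. \<lambda>(i, j)\<in>{..<n} \<times> {..<n}. w (min i j, max i j)"
  let ?A = "wigner n -` A \<inter> space (noise n)"
  have Y: "?Y \<in> ?U \<Otimes>\<^sub>M GOE n \<rightarrow>\<^sub>M mat_space n"
    by (rule measurable_spiked) simp
  have GOE: "GOE n = distr (noise n) (mat_space n) ?sym"
    unfolding GOE_def noise_eq ..
  have sym: "?sym \<in> noise n \<rightarrow>\<^sub>M mat_space n"
    unfolding noise_eq by (rule measurable_symmetrise)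
  have A': "?A \<in> sets (PiM ?T (\<lambda>_. borel))"
    using measurable_sets[OF measurable_wigner A] by (simp add: space_PiM)
  have IA: "indicator A \<circ> ?Y \<in> borel_measurable (?U \<Otimes>\<^sub>M GOE n)"
    by (rule measurable_comp[OF Y]) (use A in measurable)
  have "emeasure (GWig lam spherical_prior n) A = (\<integral>\<^sup>+y. indicator A y \<partial>GWig lam spherical_prior n)"
    using A by simp
  also have "\<dots> = (\<integral>\<^sup>+y. indicator A (?Y y) \<partial>(?U \<Otimes>\<^sub>M GOE n))"
    unfolding GWig_def using A by (intro nn_integral_distr Y) simp
  also have "\<dots> = (\<integral>\<^sup>+x. \<integral>\<^sup>+W. indicator A (?Y (x, W)) \<partial>GOE n \<partial>?U)"
    using IA unfolding comp_def by (rule G.nn_integral_fst[symmetric])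
  also have "\<dots> = (\<integral>\<^sup>+x. \<integral>\<^sup>+w. indicator ?A w * lik lam n x w \<partial>noise n \<partial>?U)"
  proof (rule nn_integral_cong)
    fix x assume "x \<in> space ?U"
    then have IAx: "(\<lambda>W. indicator A (?Y (x, W)) :: ennreal) \<in> borel_measurable (GOE n)"
      using measurable_compose[OF measurable_Pair1' IA, of x] by (simp add: comp_def)
    have "(\<integral>\<^sup>+W. indicator A (?Y (x, W)) \<partial>GOE n) = (\<integral>\<^sup>+w. indicator A (?Y (x, ?sym w)) \<partial>noise n)"
      using IAx sym by (simp only: GOE nn_integral_distr measurable_distr_eq1 refl cong: measurable_cong_sets)
    also have "\<dots> = (\<integral>\<^sup>+w. indicator ?A (\<lambda>t\<in>?T. w t + spike lam n x t) \<partial>noise n)"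
    proof (rule nn_integral_cong)
      fix w assume "w \<in> space (noise n)"
      \<comment> \<open>The rank-one matrix is symmetric, so its upper triangle determines it; n > 0
        allows \<open>sqrt n\<close> to be cancelled.\<close>
      have "?Y (x, ?sym w) = wigner n (\<lambda>t\<in>?T. w t + spike lam n x t)"
        using n by (auto simp: wigner_def spike_def upper_triangle_def fun_eq_iff min_def max_def
            add_divide_distrib)
      then show "indicator A (?Y (x, ?sym w)) = (indicator ?A (\<lambda>t\<in>?T. w t + spike lam n x t) :: ennreal)"
        by (simp add: indicator_def space_PiM)
    qed
    also have "\<dots> = (\<integral>\<^sup>+w. indicator ?A w \<partial>distr (noise n) (PiM ?T (\<lambda>_. borel))
        (\<lambda>w. \<lambda>t\<in>?T. w t + spike lam n x t))"
    proof (rule nn_integral_distr[symmetric])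
      show "(\<lambda>w. \<lambda>t\<in>?T. w t + spike lam n x t) \<in> noise n \<rightarrow>\<^sub>M PiM ?T (\<lambda>_. borel)"
        by measurable
    qed (use A' in simp)
    also have "\<dots> = (\<integral>\<^sup>+w. indicator ?A w \<partial>density (noise n) (lik lam n x))"
      unfolding lik_def by (simp only: distr_PiM_gauss_shift[OF sd_pos finite_upper_triangle])
    also have "\<dots> = (\<integral>\<^sup>+w. lik lam n x w * indicator ?A w \<partial>noise n)"
    proof (rule nn_integral_density)
      show "lik lam n x \<in> borel_measurable (noise n)"
        unfolding lik_def by measurable
    qed (use A' in \<open>simp add: sets_noise\<close>)
    finally show "(\<integral>\<^sup>+W. indicator A (?Y (x, W)) \<partial>GOE n) =
        (\<integral>\<^sup>+w. indicator ?A w * lik lam n x w \<partial>noise n)"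
      by (simp add: mult.commute)
  qed
  finally show ?thesis .
qed

section \<open>Second moment of the likelihood ratio\<close>

text \<open>Variance 2 on the diagonal gives diagonal terms weight 1/2, so the triangle is exactly
  half of the full double sum, which is a square.\<close>

lemma sum_upper_triangle:
  fixes a :: "nat \<Rightarrow> real"
  shows "(\<Sum>t\<in>upper_triangle n. a (fst t) * a (snd t) / (sd t)\<^sup>2) = (\<Sum>i<n. a i)\<^sup>2 / 2"
proof (induction n)
  case 0
  then show ?case by (simp add: upper_triangle_def)
next
  case (Suc n)
  \<comment> \<open>The new column, diagonal entry included, contributes the increment of half the
    squared sum.\<close>
  have split: "upper_triangle (Suc n) = upper_triangle n \<union> (\<lambda>i. (i, n)) ` {..n}"
    by (auto simp: upper_triangle_def)
  have "(\<Sum>t\<in>upper_triangle (Suc n). a (fst t) * a (snd t) / (sd t)\<^sup>2) =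
      (\<Sum>i<n. a i)\<^sup>2 / 2 + (\<Sum>t\<in>(\<lambda>i. (i, n)) ` {..n}. a (fst t) * a (snd t) / (sd t)\<^sup>2)"
  proof -
    have "upper_triangle n \<inter> (\<lambda>i. (i, n)) ` {..n} = {}"
      by (auto simp: upper_triangle_def)
    then show ?thesis
      unfolding split Suc.IH[symmetric] by (intro sum.union_disjoint finite_upper_triangle) simp_all
  qed
  also have "(\<Sum>t\<in>(\<lambda>i. (i, n)) ` {..n}. a (fst t) * a (snd t) / (sd t)\<^sup>2) =
      (\<Sum>i\<le>n. a i * a n / (sd (i, n))\<^sup>2)"
    by (subst sum.reindex) (auto simp: inj_on_def)
  also have "\<dots> = (\<Sum>i<n. a i) * a n + (a n)\<^sup>2 / 2"
    by (simp add: lessThan_Suc_atMost[symmetric] sd_def sum_distrib_right power2_eq_square)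
  finally show ?case
    by (simp add: power2_eq_square field_simps)
qed

lemma nn_integral_lik_mult:
  "(\<integral>\<^sup>+w. lik lam n x w * lik lam n y w \<partial>noise n) =
    ennreal (exp (lam\<^sup>2 * n * (\<Sum>i<n. y i * x i)\<^sup>2 / 2))"
proof -
  \<comment> \<open>The product of two rank-one entries is again of the form a_i a_j, with a_i = y_i
    x_i.\<close>
  have "(\<Sum>t\<in>upper_triangle n. spike lam n x t * spike lam n y t / (sd t)\<^sup>2) =
      lam\<^sup>2 * n * (\<Sum>t\<in>upper_triangle n. (y (fst t) * x (fst t)) * (y (snd t) * x (snd t)) / (sd t)\<^sup>2)"
  proof -
    have "spike lam n x t * spike lam n y t =
        (sqrt n)\<^sup>2 * lam\<^sup>2 * ((y (fst t) * x (fst t)) * (y (snd t) * x (snd t)))" for t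
      by (simp only: spike_def power2_eq_square mult_ac)
    then show ?thesis by (simp add: sum_distrib_left mult_ac)
  qed
  also have "\<dots> = lam\<^sup>2 * n * (\<Sum>i<n. y i * x i)\<^sup>2 / 2"
    by (subst sum_upper_triangle) simp
  finally show ?thesis
    unfolding lik_def by (simp add: nn_integral_shift_density_mult[OF sd_pos finite_upper_triangle])
qed

text \<open>Squaring a mixture introduces a second independent copy of the spike. Tonelli then moves
  the noise integral innermost, where it has a closed form in the inner product of the two
  copies.\<close>

lemma nn_integral_lik_second_moment:
  assumes lam: "0 \<le> lam" "lam < 1" and n: "n > 0"
  shows "(\<integral>\<^sup>+w. (\<integral>\<^sup>+x. lik lam n x w \<partial>spherical_prior n)\<^sup>2 \<partial>noise n) \<le> ennreal (1 / sqrt (1 - lam\<^sup>2))"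
proof -
  let ?U = "spherical_prior n"
  interpret U: prob_space ?U by (rule prob_space_spherical_prior)
  interpret N: prob_space "noise n" by (rule prob_space_noise)
  interpret pair_sigma_finite ?U "noise n" ..
  have [measurable]: "case_prod (lik lam n) \<in> borel_measurable (?U \<Otimes>\<^sub>M noise n)"
    using measurable_lik by (simp cong: measurable_cong_sets)
  let ?b = "\<lambda>w. \<integral>\<^sup>+x. lik lam n x w \<partial>?U"
  have "(\<integral>\<^sup>+w. (?b w)\<^sup>2 \<partial>noise n) = (\<integral>\<^sup>+w. \<integral>\<^sup>+x. lik lam n x w * ?b w \<partial>?U \<partial>noise n)"
    by (intro nn_integral_cong) (simp add: power2_eq_square nn_integral_multc)
  also have "\<dots> = (\<integral>\<^sup>+x. \<integral>\<^sup>+w. lik lam n x w * ?b w \<partial>noise n \<partial>?U)"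
    by (rule Fubini') measurable
  also have "\<dots> = (\<integral>\<^sup>+x. \<integral>\<^sup>+w. \<integral>\<^sup>+y. lik lam n x w * lik lam n y w \<partial>?U \<partial>noise n \<partial>?U)"
    by (intro nn_integral_cong) (simp add: nn_integral_cmult)
  also have "\<dots> = (\<integral>\<^sup>+x. \<integral>\<^sup>+y. \<integral>\<^sup>+w. lik lam n x w * lik lam n y w \<partial>noise n \<partial>?U \<partial>?U)"
    by (intro nn_integral_cong Fubini') measurable
  also have "\<dots> = (\<integral>\<^sup>+x. \<integral>\<^sup>+y. ennreal (exp (lam\<^sup>2 * n * (\<Sum>i<n. y i * x i)\<^sup>2 / 2)) \<partial>?U \<partial>?U)"
    by (simp add: nn_integral_lik_mult)
  also have "\<dots> \<le> (\<integral>\<^sup>+x. ennreal (1 / sqrt (1 - lam\<^sup>2)) \<partial>?U)"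
  proof (rule nn_integral_mono_AE)
    \<comment> \<open>Almost every x is a unit vector, so it can act as the fixed direction for the
      other copy.\<close>
    show "AE x in ?U. (\<integral>\<^sup>+y. ennreal (exp (lam\<^sup>2 * n * (\<Sum>i<n. y i * x i)\<^sup>2 / 2)) \<partial>?U)
        \<le> ennreal (1 / sqrt (1 - lam\<^sup>2))"
      using AE_spherical_prior_unit[OF n]
    proof eventually_elim
      case (elim x)
      show ?case
        using lam by (intro nn_integral_exp_inner_square_sphere elim) (auto simp: power_less_one_iff abs_square_less_1)
    qed
  qed
  also have "\<dots> = ennreal (1 / sqrt (1 - lam\<^sup>2))"
    using U.emeasure_space_1 by simp
  finally show ?thesis .
qed

section \<open>From the second moment to contiguity\<close>

text \<open>Cauchy-Schwarz for the indicator of the event against the mixed likelihood. An indicator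
  is its own square, so the first factor is the null probability.\<close>

lemma measure_GWig_square_le:
  assumes lam: "0 \<le> lam" "lam < 1" and n: "n > 0" and A: "A \<in> sets (mat_space n)"
  shows "(measure (GWig lam spherical_prior n) A)\<^sup>2 \<le>
    measure (GWig 0 spherical_prior n) A * (1 / sqrt (1 - lam\<^sup>2))"
proof -
  let ?U = "spherical_prior n" and ?A = "wigner n -` A \<inter> space (noise n)"
  let ?b = "\<lambda>w. \<integral>\<^sup>+x. lik lam n x w \<partial>?U"
  interpret U: prob_space ?U by (rule prob_space_spherical_prior)
  interpret N: prob_space "noise n" by (rule prob_space_noise)
  interpret pair_sigma_finite ?U "noise n" ..
  interpret P: prob_space "GWig lam spherical_prior n"
    by (intro prob_space_GWig prob_space_spherical_prior) simp
  interpret Q: prob_space "GWig 0 spherical_prior n"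
    by (intro prob_space_GWig prob_space_spherical_prior) simp
  have [measurable]: "case_prod (lik lam n) \<in> borel_measurable (?U \<Otimes>\<^sub>M noise n)"
    using measurable_lik by (simp cong: measurable_cong_sets)
  have [measurable]: "?A \<in> sets (noise n)"
    using measurable_sets[OF measurable_wigner A] by (simp add: space_PiM sets_noise)
  have P: "emeasure (GWig lam spherical_prior n) A = (\<integral>\<^sup>+w. indicator ?A w * ?b w \<partial>noise n)"
  proof -
    have "emeasure (GWig lam spherical_prior n) A =
        (\<integral>\<^sup>+w. \<integral>\<^sup>+x. indicator ?A w * lik lam n x w \<partial>?U \<partial>noise n)"
      unfolding emeasure_GWig_spherical[OF A n] by (rule Fubini'[symmetric]) measurable
    also have "\<dots> = (\<integral>\<^sup>+w. indicator ?A w * ?b w \<partial>noise n)"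
      by (intro nn_integral_cong) (simp add: nn_integral_cmult)
    finally show ?thesis .
  qed
  have Q: "emeasure (GWig 0 spherical_prior n) A = (\<integral>\<^sup>+w. (indicator ?A w)\<^sup>2 \<partial>noise n)"
  proof -
    have "lik 0 n x w = 1" for x w by (simp add: lik_def spike_def)
    moreover have "(indicator ?A w)\<^sup>2 = (indicator ?A w :: ennreal)" for w
      by (simp add: indicator_def)
    ultimately show ?thesis
      using U.emeasure_space_1 by (simp add: emeasure_GWig_spherical[OF A n])
  qed
  have "(emeasure (GWig lam spherical_prior n) A)\<^sup>2 \<le>
      emeasure (GWig 0 spherical_prior n) A * (\<integral>\<^sup>+w. (?b w)\<^sup>2 \<partial>noise n)"
    unfolding P Q by (rule Cauchy_Schwarz_nn_integral) measurable
  also have "\<dots> \<le> emeasure (GWig 0 spherical_prior n) A * ennreal (1 / sqrt (1 - lam\<^sup>2))"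
    by (intro mult_left_mono nn_integral_lik_second_moment lam n) simp
  finally have "ennreal ((measure (GWig lam spherical_prior n) A)\<^sup>2) \<le>
      ennreal (measure (GWig 0 spherical_prior n) A * (1 / sqrt (1 - lam\<^sup>2)))"
    by (simp only: P.emeasure_eq_measure Q.emeasure_eq_measure ennreal_power ennreal_mult' measure_nonneg)
  moreover have "0 \<le> 1 / sqrt (1 - lam\<^sup>2)"
    using lam by (simp add: abs_square_le_1)
  ultimately show ?thesis
    by (subst (asm) ennreal_le_iff) auto
qed

theorem theorem3p7:
  fixes lam :: real
  assumes "0 \<le> lam" and "lam < 1"
  shows "contiguous (GWig lam spherical_prior) (GWig 0 spherical_prior)"
  unfolding contiguous_def
proof (intro conjI allI impI)
  fix n
  show "prob_space (GWig lam spherical_prior n)" "prob_space (GWig 0 spherical_prior n)"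
    by (intro prob_space_GWig prob_space_spherical_prior; simp)+
  show "sets (GWig lam spherical_prior n) = sets (GWig 0 spherical_prior n)"
    by simp
next
  fix A assume A: "\<forall>n. A n \<in> sets (GWig 0 spherical_prior n)"
    and Q: "(\<lambda>n. measure (GWig 0 spherical_prior n) (A n)) \<longlonglongrightarrow> 0"
  let ?C = "1 / sqrt (1 - lam\<^sup>2)"
  \<comment> \<open>\<open>?C\<close> does not depend on n, so vanishing null probabilities force
    the squares to zero.\<close>
  have "(\<lambda>n. (measure (GWig lam spherical_prior n) (A n))\<^sup>2) \<longlonglongrightarrow> 0"
  proof (rule tendsto_sandwich[OF _ _ tendsto_const])
    show "(\<lambda>n. measure (GWig 0 spherical_prior n) (A n) * ?C) \<longlonglongrightarrow> 0"
      using tendsto_mult_right[OF Q, of ?C] by simp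
    \<comment> \<open>The estimate is stated for n > 0; dimension zero is discarded by passing to a
      tail.\<close>
    show "\<forall>\<^sub>F n in sequentially. (measure (GWig lam spherical_prior n) (A n))\<^sup>2 \<le>
        measure (GWig 0 spherical_prior n) (A n) * ?C"
      using eventually_gt_at_top[of 0]
      by eventually_elim (use A assms in \<open>intro measure_GWig_square_le, auto\<close>)
  qed simp
  then have "(\<lambda>n. sqrt ((measure (GWig lam spherical_prior n) (A n))\<^sup>2)) \<longlonglongrightarrow> sqrt 0"
    by (rule tendsto_real_sqrt)
  then show "(\<lambda>n. measure (GWig lam spherical_prior n) (A n)) \<longlonglongrightarrow> 0"
    by simp
qed

end
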